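(* Let $\mathbf n$ be a sequence with gaps. The following are equivalent: (i) $\mathbf n$ has bounded additive gaps. (ii) Every basis (of any Banach space) that is $\mathbf n$-unconditional for constant coefficients is unconditional for constant coefficients. (iii) Every Markushevich basis (of any Banach space) that is $\mathbf n$-unconditional for constant coefficients is unconditional for constant coefficients. (iv) Every basis (of any Banach space) that has the $\mathbf n$-UL property has the UL property. (v) Every Markushevich basis (of any Banach space) that has the $\mathbf n$-UL property has the UL property.
   Context: Banach spaces $\mathbb X$ are separable and infinite-dimensional over $\mathbb F=\mathbb R$ or $\mathbb C$, with dual $\mathbb X^*$. A basis of $\mathbb X$ is a sequence $\mathcal B=(\mathbf e_i)_{i\in\mathbb N}\subset\mathbb X$ with closed linear span $\mathbb X$, having a (unique) sequence of biorthogonal functionals $(\mathbf e_i^* )_{i\in\mathbb N}\subset\mathbb X^*$ ($\mathbf e_k^*(\mathbf e_i)=\delta_{k,i}$), with $0<\inf_i\min\{\|\mathbf e_i\|,\|\mathbf e_i^*\|\}\le\sup_i\max\{\|\mathbf e_i\|,\|\mathbf e_i^*\|\}<\infty$. It is a Markushevich basis if, in addition, $\mathbf e_i^*(x)=0$ for all $i$ implies $x=0$. A sequence with gaps is a strictly increasing sequence $\mathbf n=(n_k)_{k\in\mathbb N}$ of positive integers (for convenience $\mathbf n=\mathbb N$ is also allowed), also regarded as a subset of $\mathbb N$. It has bounded additive gaps if there is an integer $l\ge2$ with $n_{k+1}-n_k\le l$ for all $k$. For a finite $A\subset\mathbb N$, $\Psi_A$ is the set of families $\varepsilon=(\varepsilon_n)_{n\in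 A}\subset\mathbb F$ with $|\varepsilon_n|=1$, $\mathbf 1_{\varepsilon A}=\sum_{n\in A}\varepsilon_n\mathbf e_n$ and $\mathbf 1_A=\sum_{n\in A}\mathbf e_n$. $\mathcal B$ is $\mathbf n$-unconditional for constant coefficients if there is $\mathbf C>0$ with $\|\mathbf 1_{\varepsilon A}\|\le\mathbf C\|\mathbf 1_{\varepsilon'A}\|$ for all $A\subset\mathbb N$ with $|A|\in\mathbf n$ and all $\varepsilon,\varepsilon'\in\Psi_A$. $\mathcal B$ has the $\mathbf n$-UL property if there are $\mathbf C_1,\mathbf C_2>0$ with $\frac1{\mathbf C_1}\min_{i\in A}|a_i|\,\|\mathbf 1_A\|\le\|\sum_{i\in A}a_i\mathbf e_i\|\le\mathbf C_2\max_{i\in A}|a_i|\,\|\mathbf 1_A\|$ for all $A\subset\mathbb N$ with $|A|\in\mathbf n$ and all scalars $(a_i)_{i\in A}$. The prefix $\mathbf n$ is omitted when $\mathbf n=\mathbb N$. *)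

theory Defs
  imports
    "HOL-Analysis.Analysis"
    "HOL-Library.Equipollence"
    "HOL-Algebra.Module"
    "HOL-Algebra.Algebraic_Closure_Type"
begin

text \<open>
  The results concern all Banach spaces at once, so a Banach space has to be a value and not a
  type class instance. It is given by a carrier set with explicit operations: a \<^locale>\<open>module\<close>
  over the scalar field together with a norm. The \<^const>\<open>monoid.mult\<close> and \<^const>\<open>monoid.one\<close>
  fields that the record inherits from \<^typ>\<open>'u ring\<close> carry no information.

  The scalar field is a type \<open>'k::{real_normed_field,euclidean_space}\<close>. Both \<^typ>\<open>real\<close> and
  \<^typ>\<open>complex\<close> are instances; by the Gelfand--Mazur theorem every other instance is isometrically
  isomorphic to one of these two.
\<close>

record ('k, 'u) nspace = "('k, 'u) module" +
  nrm :: "'u \<Rightarrow> real"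

locale normed_space =
  module "ring_of_type_algebra :: 'k::{real_normed_field,euclidean_space} ring" V
  for V :: "('k::{real_normed_field,euclidean_space}, 'u) nspace" (structure) +
  assumes nrm_eq_zero: "x \<in> carrier V \<Longrightarrow> nrm V x = 0 \<longleftrightarrow> x = \<zero>\<^bsub>V\<^esub>"
    and nrm_smult: "x \<in> carrier V \<Longrightarrow> nrm V (a \<odot>\<^bsub>V\<^esub> x) = norm a * nrm V x"
    and nrm_triangle:
      "x \<in> carrier V \<Longrightarrow> y \<in> carrier V \<Longrightarrow> nrm V (x \<oplus>\<^bsub>V\<^esub> y) \<le> nrm V x + nrm V y"

text \<open>
  The locale \<^locale>\<open>Metric_space\<close> requires nonnegativity and symmetry of the distance also off the
  carrier, hence the default value 0 there.
\<close>

definition ndist :: "('k, 'u) nspace \<Rightarrow> 'u \<Rightarrow> 'u \<Rightarrow> real" where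
  "ndist V x y = (if x \<in> carrier V \<and> y \<in> carrier V then nrm V (x \<ominus>\<^bsub>V\<^esub> y) else 0)"

definition ntopology :: "('k, 'u) nspace \<Rightarrow> 'u topology" where
  "ntopology V = Metric_space.mtopology (carrier V) (ndist V)"

context normed_space
begin

lemma nrm_minus: "x \<in> carrier V \<Longrightarrow> nrm V (\<ominus>\<^bsub>V\<^esub> x) = nrm V x"
proof -
  assume x: "x \<in> carrier V"
  let ?R = "ring_of_type_algebra :: 'k ring"
  have c: "(1::'k) \<in> carrier ?R" "(-1::'k) \<in> carrier ?R"
    by (simp_all add: ring_of_type_algebra_def)
  have one: "(1::'k) \<odot>\<^bsub>V\<^esub> x = x"
    using smult_one[OF x] by (simp add: ring_of_type_algebra_def)
  have zero: "(0::'k) \<odot>\<^bsub>V\<^esub> x = \<zero>\<^bsub>V\<^esub>"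
    using smult_l_null[OF x] by (simp add: ring_of_type_algebra_def)
  have "((-1::'k) + 1) \<odot>\<^bsub>V\<^esub> x = (-1::'k) \<odot>\<^bsub>V\<^esub> x \<oplus>\<^bsub>V\<^esub> (1::'k) \<odot>\<^bsub>V\<^esub> x"
    using smult_l_distr[OF c(2) c(1) x] by (simp add: ring_of_type_algebra_def)
  then have "(-1::'k) \<odot>\<^bsub>V\<^esub> x \<oplus>\<^bsub>V\<^esub> x = \<zero>\<^bsub>V\<^esub>"
    by (simp add: one zero)
  then have "\<ominus>\<^bsub>V\<^esub> x = (-1::'k) \<odot>\<^bsub>V\<^esub> x"
    using M.minus_equality[OF _ x smult_closed[OF c(2) x]] by simp
  then show ?thesis
    using nrm_smult[OF x, of "-1"] by simp
qed

lemma nrm_nonneg: "x \<in> carrier V \<Longrightarrow> 0 \<le> nrm V x"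
  using nrm_triangle[of x "\<ominus>\<^bsub>V\<^esub> x"] nrm_minus[of x] nrm_eq_zero[of "\<zero>\<^bsub>V\<^esub>"]
  by (simp add: M.r_neg)

sublocale Metric_space "carrier V" "ndist V"
proof
  show "0 \<le> ndist V x y" for x y
    by (simp add: ndist_def nrm_nonneg)
  show "ndist V x y = ndist V y x" for x y
  proof (cases "x \<in> carrier V \<and> y \<in> carrier V")
    case True
    then have "\<ominus>\<^bsub>V\<^esub> (x \<ominus>\<^bsub>V\<^esub> y) = y \<ominus>\<^bsub>V\<^esub> x"
      by (simp add: M.minus_add M.minus_minus a_minus_def M.a_comm)
    with True show ?thesis
      using nrm_minus[of "x \<ominus>\<^bsub>V\<^esub> y"] by (simp add: ndist_def)
  qed (auto simp: ndist_def)
  show "ndist V x y = 0 \<longleftrightarrow> x = y" if "x \<in> carrier V" "y \<in> carrier V" for x y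
  proof -
    have "x \<ominus>\<^bsub>V\<^esub> y = \<zero>\<^bsub>V\<^esub> \<Longrightarrow> x = y"
      using that M.minus_equality[of x "\<ominus>\<^bsub>V\<^esub> y"] by (simp add: a_minus_def)
    moreover have "x = y \<Longrightarrow> x \<ominus>\<^bsub>V\<^esub> y = \<zero>\<^bsub>V\<^esub>"
      using that by (simp add: a_minus_def M.r_neg)
    ultimately show ?thesis
      using that by (auto simp: ndist_def nrm_eq_zero)
  qed
  show "ndist V x z \<le> ndist V x y + ndist V y z"
    if "x \<in> carrier V" "y \<in> carrier V" "z \<in> carrier V" for x y z
  proof -
    have "x \<ominus>\<^bsub>V\<^esub> z = (x \<ominus>\<^bsub>V\<^esub> y) \<oplus>\<^bsub>V\<^esub> (y \<ominus>\<^bsub>V\<^esub> z)"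
      using that by (simp add: a_minus_def M.a_ac M.r_neg1 M.r_neg2)
    with that show ?thesis
      using nrm_triangle[of "x \<ominus>\<^bsub>V\<^esub> y" "y \<ominus>\<^bsub>V\<^esub> z"] by (simp add: ndist_def)
  qed
qed

end

definition lin_span :: "('k::real_normed_field, 'u) nspace \<Rightarrow> 'u set \<Rightarrow> 'u set" where
  "lin_span V S = {\<Oplus>\<^bsub>V\<^esub>v\<in>A. a v \<odot>\<^bsub>V\<^esub> v | A a. finite A \<and> A \<subseteq> S}"

text \<open>Separability and infinite dimension are standing assumptions on the spaces considered.\<close>

definition banach_space :: "('k::{real_normed_field,euclidean_space}, 'u) nspace \<Rightarrow> bool" where
  "banach_space V \<longleftrightarrow>
     normed_space V \<and>
     Metric_space.mcomplete (carrier V) (ndist V) \<and>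
     separable_space (ntopology V) \<and>
     (\<nexists>S. finite S \<and> S \<subseteq> carrier V \<and> lin_span V S = carrier V)"

text \<open>
  Functionals are HOL functions whose values off the carrier are unconstrained, so uniqueness of
  the biorthogonal functionals is uniqueness on the carrier.
\<close>

definition dual :: "('k::real_normed_field, 'u) nspace \<Rightarrow> ('u \<Rightarrow> 'k) set" where
  "dual V = {f. (\<forall>x\<in>carrier V. \<forall>y\<in>carrier V. f (x \<oplus>\<^bsub>V\<^esub> y) = f x + f y) \<and>
                (\<forall>a. \<forall>x\<in>carrier V. f (a \<odot>\<^bsub>V\<^esub> x) = a * f x) \<and>
                continuous_map (ntopology V) euclidean f}"

definition dual_nrm :: "('k::real_normed_field, 'u) nspace \<Rightarrow> ('u \<Rightarrow> 'k) \<Rightarrow> real" where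
  "dual_nrm V f = (SUP x\<in>{x \<in> carrier V. nrm V x \<le> 1}. norm (f x))"

text \<open>
  \<open>basis_pair V e f\<close>: \<open>e\<close> is a basis of \<open>V\<close> with biorthogonal functionals \<open>f\<close>. As \<open>e\<close> has dense
  span, \<open>f\<close> is determined by \<open>e\<close> on the carrier. The condition \<^const>\<open>bdd_above\<close> says that the
  supremum is finite; the infimum is one of nonnegative reals.
\<close>

definition basis_pair ::
    "('k::real_normed_field, 'u) nspace \<Rightarrow> (nat \<Rightarrow> 'u) \<Rightarrow> (nat \<Rightarrow> 'u \<Rightarrow> 'k) \<Rightarrow> bool" where
  "basis_pair V e f \<longleftrightarrow>
     range e \<subseteq> carrier V \<and>
     ntopology V closure_of lin_span V (range e) = carrier V \<and>
     range f \<subseteq> dual V \<and>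
     (\<forall>k i. f k (e i) = (if k = i then 1 else 0)) \<and>
     0 < (INF i. min (nrm V (e i)) (dual_nrm V (f i))) \<and>
     bdd_above (range (\<lambda>i. max (nrm V (e i)) (dual_nrm V (f i))))"

definition is_basis :: "('k::real_normed_field, 'u) nspace \<Rightarrow> (nat \<Rightarrow> 'u) \<Rightarrow> bool" where
  "is_basis V e \<longleftrightarrow> (\<exists>f. basis_pair V e f)"

definition markushevich_basis :: "('k::real_normed_field, 'u) nspace \<Rightarrow> (nat \<Rightarrow> 'u) \<Rightarrow> bool" where
  "markushevich_basis V e \<longleftrightarrow>
     (\<exists>f. basis_pair V e f \<and> (\<forall>x\<in>carrier V. (\<forall>i. f i x = 0) \<longrightarrow> x = \<zero>\<^bsub>V\<^esub>))"

definition lin_comb ::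
    "('k, 'u) nspace \<Rightarrow> (nat \<Rightarrow> 'u) \<Rightarrow> (nat \<Rightarrow> 'k) \<Rightarrow> nat set \<Rightarrow> 'u" where
  "lin_comb V e a A = (\<Oplus>\<^bsub>V\<^esub>i\<in>A. a i \<odot>\<^bsub>V\<^esub> e i)"

text \<open>
  The parameter \<open>N\<close> below is the set of values of a sequence of positive integers. A family
  indexed by \<open>A\<close> is a function on \<^typ>\<open>nat\<close> of which only the values on \<open>A\<close> matter.
\<close>

definition uncond_const_coeff ::
    "nat set \<Rightarrow> ('k::real_normed_field, 'u) nspace \<Rightarrow> (nat \<Rightarrow> 'u) \<Rightarrow> bool" where
  "uncond_const_coeff N V e \<longleftrightarrow>
     (\<exists>C>0. \<forall>A \<epsilon> \<epsilon>'. finite A \<and> card A \<in> N \<and>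
        (\<forall>i\<in>A. norm (\<epsilon> i) = 1) \<and> (\<forall>i\<in>A. norm (\<epsilon>' i) = 1) \<longrightarrow>
        nrm V (lin_comb V e \<epsilon> A) \<le> C * nrm V (lin_comb V e \<epsilon>' A))"

definition UL_property ::
    "nat set \<Rightarrow> ('k::real_normed_field, 'u) nspace \<Rightarrow> (nat \<Rightarrow> 'u) \<Rightarrow> bool" where
  "UL_property N V e \<longleftrightarrow>
     (\<exists>C\<^sub>1>0. \<exists>C\<^sub>2>0. \<forall>A a. finite A \<and> card A \<in> N \<longrightarrow>
        1 / C\<^sub>1 * (MIN i\<in>A. norm (a i)) * nrm V (lin_comb V e (\<lambda>_. 1) A)
          \<le> nrm V (lin_comb V e a A) \<and>
        nrm V (lin_comb V e a A)
          \<le> C\<^sub>2 * (MAX i\<in>A. norm (a i)) * nrm V (lin_comb V e (\<lambda>_. 1) A))"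

definition gap_sequence :: "(nat \<Rightarrow> nat) \<Rightarrow> bool" where
  "gap_sequence n \<longleftrightarrow> strict_mono n \<and> (\<forall>k. 0 < n k)"

definition bounded_additive_gaps :: "(nat \<Rightarrow> nat) \<Rightarrow> bool" where
  "bounded_additive_gaps n \<longleftrightarrow> (\<exists>l\<ge>2. \<forall>k. n (Suc k) - n k \<le> l)"

text \<open>
  Quantification over all Banach spaces is quantification over all structures whose carrier is a
  subset of a type \<open>'u\<close>. A separable Banach space has at most continuum many points, so the
  assumption \<open>(UNIV :: real set) \<lesssim> (UNIV :: 'u set)\<close> makes every space under consideration
  isometrically isomorphic to one with carrier in \<open>'u\<close>.
\<close>

end

theory Submission
  imports Defs "HOL-Library.Function_Algebras"
begin

text \<open>
  Suppose first that the gaps are bounded. A finite set \<open>A\<close> contains a set \<open>B\<close> of a size in the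
  sequence with \<open>A - B\<close> of bounded size, or else \<open>A\<close> itself is of bounded size
  (\<open>bounded_gaps_subset\<close>). Adding or removing boundedly many coordinates changes a norm by at most
  a constant times the largest coefficient involved, and biorthogonality bounds every coefficient
  by the norm (\<open>basis_estimates\<close>). So each property passes from \<open>B\<close> to \<open>A\<close>, with a larger
  constant.

  For the converse one space refutes all four statements at once. The UL property implies
  unconditionality for constant coefficients for the same sizes, so it suffices to find, for
  unbounded gaps, a Markushevich basis that has the UL property for the sizes in the sequence but
  is not unconditional for constant coefficients (\<open>counterexample\<close>).

  Consider consecutive blocks of naturals whose lengths lie inside longer and longer gaps, far
  from both ends. The \<open>k\<close>-th seminorm ignores the coordinates before the \<open>k\<close>-th block, subtracts
  the mean over the block from the coordinates in the block, and adds up the \<open>d k\<close> largest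
  absolute values; the norm is the supremum of these seminorms and of the coordinates. The \<open>k\<close>-th
  seminorm vanishes on the indicator of its block, but is at least \<open>d k\<close> when \<open>d k\<close> of the signs
  are flipped. As \<open>d\<close> grows fast, the earlier seminorms do not compensate for that, and the later
  ones do not see the block: signs matter (\<open>gauge_block_indicator\<close>, \<open>gauge_block_signs\<close>).

  A set \<open>A\<close> of a size in the sequence, however, misses at least \<open>d k\<close> elements of the block or has
  at least \<open>d k\<close> elements beyond it, so subtracting the mean cannot make the seminorm small. For a
  combination over \<open>A\<close> it lies, up to constants, between the smallest and the largest coefficient
  times \<open>min (card (A \<inter> {s k..})) (d k)\<close>, whatever the signs are (\<open>block_lower\<close>,
  \<open>block_upper\<close>). This is the UL property for these sizes.

  The space is the closure of the finitely supported sequences under this norm. That it is a Banach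
  space with the unit vectors as a Markushevich basis holds for any supremum of seminorms that are
  uniformly bounded on the unit vectors, continuous under coordinatewise convergence, and include
  the absolute values of the coordinates.
\<close>

section \<open>Finite linear combinations in a normed space\<close>

context normed_space
begin

lemma scalar_mult_closed [simp, intro]: "x \<in> carrier V \<Longrightarrow> a \<odot>\<^bsub>V\<^esub> x \<in> carrier V"
  using smult_closed[of a x] by (simp add: ring_of_type_algebra_def)

lemma lin_comb_closed: "range e \<subseteq> carrier V \<Longrightarrow> lin_comb V e a A \<in> carrier V"
  unfolding lin_comb_def by (rule M.finsum_closed) auto

lemma lin_comb_empty: "lin_comb V e a {} = \<zero>\<^bsub>V\<^esub>"
  by (simp add: lin_comb_def)

lemma lin_comb_insert:
  "range e \<subseteq> carrier V \<Longrightarrow> finite A \<Longrightarrow> i \<notin> A \<Longrightarrow>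
    lin_comb V e a (insert i A) = a i \<odot>\<^bsub>V\<^esub> e i \<oplus>\<^bsub>V\<^esub> lin_comb V e a A"
  unfolding lin_comb_def by (rule M.finsum_insert) auto

lemma lin_comb_split:
  assumes e: "range e \<subseteq> carrier V" and A: "finite A" "B \<subseteq> A"
  shows "lin_comb V e a A = lin_comb V e a B \<oplus>\<^bsub>V\<^esub> lin_comb V e a (A - B)"
proof -
  have "lin_comb V e a (B \<union> (A - B)) = lin_comb V e a B \<oplus>\<^bsub>V\<^esub> lin_comb V e a (A - B)"
    unfolding lin_comb_def
    by (rule M.finsum_Un_disjoint) (use e A in \<open>auto simp: finite_subset\<close>)
  moreover have "B \<union> (A - B) = A"
    using A by auto
  ultimately show ?thesis
    by simp
qed

lemma nrm_zero: "nrm V \<zero>\<^bsub>V\<^esub> = 0"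
  by (simp add: nrm_eq_zero)

lemma nrm_lin_comb_le:
  assumes e: "range e \<subseteq> carrier V" and K: "\<And>i. nrm V (e i) \<le> K"
    and A: "finite A" and M: "\<And>i. i \<in> A \<Longrightarrow> norm (a i) \<le> M"
  shows "nrm V (lin_comb V e a A) \<le> K * real (card A) * M"
  using A M
proof (induction A)
  case empty
  then show ?case
    by (simp add: lin_comb_empty nrm_zero)
next
  case (insert i A)
  have ei: "e i \<in> carrier V"
    using e by auto
  have "nrm V (lin_comb V e a (insert i A)) \<le> nrm V (a i \<odot>\<^bsub>V\<^esub> e i) + nrm V (lin_comb V e a A)"
    using insert ei by (simp add: lin_comb_insert e nrm_triangle lin_comb_closed)
  also have "nrm V (a i \<odot>\<^bsub>V\<^esub> e i) \<le> M * K"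
    unfolding nrm_smult[OF ei]
    by (rule mult_mono)
      (use insert.prems[of i] K nrm_nonneg[OF ei] in \<open>auto intro: order_trans[OF norm_ge_zero]\<close>)
  also have "nrm V (lin_comb V e a A) \<le> K * real (card A) * M"
    using insert by simp
  finally show ?case
    using insert by (simp add: algebra_simps)
qed

lemma dual_zero:
  assumes f: "f \<in> dual V"
  shows "f \<zero>\<^bsub>V\<^esub> = 0"
proof -
  have "f (\<zero>\<^bsub>V\<^esub> \<oplus>\<^bsub>V\<^esub> \<zero>\<^bsub>V\<^esub>) = f \<zero>\<^bsub>V\<^esub> + f \<zero>\<^bsub>V\<^esub>"
    using f M.zero_closed unfolding dual_def by blast
  then show ?thesis
    by simp
qed

lemma dual_lin_comb:
  assumes e: "range e \<subseteq> carrier V" and f: "f \<in> dual V" and A: "finite A"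
  shows "f (lin_comb V e a A) = (\<Sum>i\<in>A. a i * f (e i))"
  using A
proof (induction A)
  case empty
  show ?case
    by (simp add: lin_comb_empty dual_zero f)
next
  case (insert i A)
  have ei: "e i \<in> carrier V"
    using e by auto
  then show ?case
    using insert f e by (simp add: lin_comb_insert dual_def lin_comb_closed)
qed

text \<open>
  \<^const>\<open>dual_nrm\<close> is a conditional supremum, so it bounds a functional only once continuity has shown
  that the functional is bounded on the unit ball.
\<close>

lemma dual_bounded:
  assumes f: "f \<in> dual V"
  shows "bdd_above ((\<lambda>x. norm (f x)) ` {x \<in> carrier V. nrm V x \<le> 1})"
proof -
  have lin: "f (a \<odot>\<^bsub>V\<^esub> x) = a * f x" if "x \<in> carrier V" for a x
    using f that by (simp add: dual_def)
  define U where "U = {x \<in> carrier V. f x \<in> ball 0 1}"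
  have "continuous_map mtopology euclidean f"
    using f by (simp add: dual_def ntopology_def)
  then have "openin mtopology {x \<in> topspace mtopology. f x \<in> ball 0 1}"
    by (rule openin_continuous_map_preimage) (simp add: open_openin[symmetric])
  then have U: "openin mtopology U"
    by (simp only: topspace_mtopology U_def)
  have "f \<zero>\<^bsub>V\<^esub> = 0"
    by (rule dual_zero[OF f])
  then have "\<zero>\<^bsub>V\<^esub> \<in> U"
    by (simp add: U_def)
  then obtain r where r: "r > 0" "mball \<zero>\<^bsub>V\<^esub> r \<subseteq> U"
    using U unfolding openin_mtopology by blast
  have "norm (f x) \<le> 2 / r" if x: "x \<in> carrier V" "nrm V x \<le> 1" for x
  proof -
    define y where "y = (of_real (r / 2) :: 'k) \<odot>\<^bsub>V\<^esub> x"
    have y: "y \<in> carrier V" "nrm V y < r"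
      using x r mult_left_mono[of "nrm V x" 1 "r / 2"]
      unfolding y_def by (auto simp: nrm_smult norm_divide)
    then have "y \<in> mball \<zero>\<^bsub>V\<^esub> r"
      by (simp add: in_mball ndist_def a_minus_def nrm_minus)
    then have "norm (f y) < 1"
      using r(2) by (auto simp: U_def)
    moreover have "norm (f y) = r / 2 * norm (f x)"
      using x r unfolding y_def by (simp add: lin norm_mult norm_divide)
    ultimately show ?thesis
      using r by (simp add: field_simps)
  qed
  then show ?thesis
    unfolding bdd_above_def by blast
qed

lemma dual_norm_le:
  assumes f: "f \<in> dual V" and x: "x \<in> carrier V"
  shows "norm (f x) \<le> dual_nrm V f * nrm V x"
proof (cases "nrm V x = 0")
  case True
  then have "x = \<zero>\<^bsub>V\<^esub>"
    using x by (simp add: nrm_eq_zero)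
  moreover have "f \<zero>\<^bsub>V\<^esub> = 0"
    by (rule dual_zero[OF f])
  ultimately show ?thesis
    using True by simp
next
  case False
  then have pos: "nrm V x > 0"
    using nrm_nonneg[OF x] by simp
  define y where "y = (of_real (1 / nrm V x) :: 'k) \<odot>\<^bsub>V\<^esub> x"
  have "y \<in> carrier V" "nrm V y = 1"
    using x pos unfolding y_def by (auto simp: nrm_smult norm_divide)
  then have "norm (f y) \<le> dual_nrm V f"
    unfolding dual_nrm_def by (intro cSUP_upper dual_bounded f) auto
  moreover have "norm (f y) = norm (f x) / nrm V x"
    using f x pos unfolding y_def by (simp add: dual_def norm_mult norm_divide)
  ultimately show ?thesis
    using pos by (simp add: field_simps)
qed

text \<open>
  Everything that the extension to further sizes uses of a basis: a coefficient is at most a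
  constant times the norm, and changing the index set by \<open>r\<close> elements moves the norm by at most
  a constant times \<open>r\<close> times the largest coefficient.
\<close>

lemma basis_estimates:
  assumes "is_basis V e"
  obtains K where "K > 0" "range e \<subseteq> carrier V"
    "\<And>a A i. finite A \<Longrightarrow> i \<in> A \<Longrightarrow> norm (a i) \<le> K * nrm V (lin_comb V e a A)"
    "\<And>a A B M. finite A \<Longrightarrow> B \<subseteq> A \<Longrightarrow> (\<And>i. i \<in> A \<Longrightarrow> norm (a i) \<le> M) \<Longrightarrow>
      nrm V (lin_comb V e a A) \<le> nrm V (lin_comb V e a B) + K * card (A - B) * M"
    "\<And>a A B M. finite A \<Longrightarrow> B \<subseteq> A \<Longrightarrow> (\<And>i. i \<in> A \<Longrightarrow> norm (a i) \<le> M) \<Longrightarrow>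
      nrm V (lin_comb V e a B) \<le> nrm V (lin_comb V e a A) + K * card (A - B) * M"
proof -
  obtain f where f: "basis_pair V e f"
    using assms by (auto simp: is_basis_def)
  then have e: "range e \<subseteq> carrier V" and dual: "\<And>i. f i \<in> dual V"
    and biorth: "\<And>k i. f k (e i) = (if k = i then 1 else 0)"
    by (auto simp: basis_pair_def)
  obtain K where K: "\<And>i. max (nrm V (e i)) (dual_nrm V (f i)) \<le> K"
    using f unfolding basis_pair_def bdd_above_def by auto
  then have Ke: "nrm V (e i) \<le> K" and Kf: "dual_nrm V (f i) \<le> K" for i
    using K[of i] by auto
  have "1 \<le> K * K"
  proof -
    have e0: "e 0 \<in> carrier V"
      using e by auto
    have "1 = norm (f 0 (e 0))"
      by (simp add: biorth)
    also have "\<dots> \<le> dual_nrm V (f 0) * nrm V (e 0)"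
      by (rule dual_norm_le[OF dual e0])
    also have "\<dots> \<le> K * K"
      by (intro mult_mono Ke Kf nrm_nonneg e0 order_trans[OF nrm_nonneg[OF e0] Ke])
    finally show ?thesis .
  qed
  moreover have "0 \<le> K"
    using order_trans[OF nrm_nonneg Ke[of 0]] e by auto
  ultimately have Kpos: "K > 0"
    by (cases "K = 0") auto
  have coeff: "norm (a i) \<le> K * nrm V (lin_comb V e a A)" if A: "finite A" "i \<in> A" for a A i
  proof -
    have "norm (a i) = norm (f i (lin_comb V e a A))"
      using A by (simp add: dual_lin_comb[OF e dual] biorth if_distrib[of "(*) _"] cong: if_cong)
    also have "\<dots> \<le> dual_nrm V (f i) * nrm V (lin_comb V e a A)"
      by (rule dual_norm_le[OF dual lin_comb_closed[OF e]])
    also have "\<dots> \<le> K * nrm V (lin_comb V e a A)"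
      by (intro mult_right_mono Kf nrm_nonneg lin_comb_closed e)
    finally show ?thesis .
  qed
  have tail: "nrm V (lin_comb V e a (A - B)) \<le> K * card (A - B) * M"
    if "finite A" "\<And>i. i \<in> A \<Longrightarrow> norm (a i) \<le> M" for a A B M
    using that by (intro nrm_lin_comb_le e Ke) auto
  show ?thesis
  proof (rule that[OF Kpos e coeff])
    fix a :: "nat \<Rightarrow> 'k" and A B M
    assume A: "finite A" "B \<subseteq> A" "\<And>i. i \<in> A \<Longrightarrow> norm (a i) \<le> M"
    let ?x = "lin_comb V e a A" and ?y = "lin_comb V e a B" and ?z = "lin_comb V e a (A - B)"
    have c: "?x \<in> carrier V" "?y \<in> carrier V" "?z \<in> carrier V"
      by (simp_all add: lin_comb_closed e)
    have split: "?x = ?y \<oplus>\<^bsub>V\<^esub> ?z"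
      by (rule lin_comb_split) (use A e in auto)
    show "nrm V ?x \<le> nrm V ?y + K * card (A - B) * M"
      using nrm_triangle[OF c(2,3)] tail[of A a M B, OF A(1,3)] split by simp
    have "?y = ?x \<oplus>\<^bsub>V\<^esub> \<ominus>\<^bsub>V\<^esub> ?z"
      using c split by (simp add: M.a_assoc M.r_neg)
    then show "nrm V ?y \<le> nrm V ?x + K * card (A - B) * M"
      using nrm_triangle[of ?x "\<ominus>\<^bsub>V\<^esub> ?z"] tail[of A a M B, OF A(1,3)] c by (simp add: nrm_minus)
  qed auto
qed

end

section \<open>Bounded gaps suffice\<close>

text \<open>
  For \<open>B\<close>, take as many elements as the largest term not exceeding \<open>card A\<close>. Sets smaller than the
  first term are why the empty set has to be allowed; it is harmless, as both sides of every norm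
  inequality then vanish.
\<close>

lemma bounded_gaps_subset:
  assumes n: "gap_sequence n" "bounded_additive_gaps n"
  obtains L where "\<And>A :: nat set. finite A \<Longrightarrow>
    \<exists>B\<subseteq>A. (card B \<in> range n \<or> B = {}) \<and> card (A - B) \<le> L"
proof -
  obtain l where l: "\<And>k. n (Suc k) - n k \<le> l"
    using n by (auto simp: bounded_additive_gaps_def)
  have mono: "strict_mono n"
    using n by (simp add: gap_sequence_def)
  have "\<exists>B\<subseteq>A. (card B \<in> range n \<or> B = {}) \<and> card (A - B) \<le> max l (n 0)"
    if A: "finite A" for A :: "nat set"
  proof (cases "card A < n 0")
    case True
    then show ?thesis
      by (intro exI[of _ "{}"]) auto
  next
    case False
    define k where "k = (LEAST k. card A < n (Suc k))"
    have "card A < n (Suc (card A))"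
      using strict_mono_imp_increasing[OF mono, of "Suc (card A)"] by simp
    then have k: "card A < n (Suc k)"
      unfolding k_def by (rule LeastI)
    have "n k \<le> card A"
    proof (cases k)
      case 0
      then show ?thesis
        using False by simp
    next
      case (Suc j)
      then show ?thesis
        using not_less_Least[of j "\<lambda>k. card A < n (Suc k)"] by (simp add: k_def)
    qed
    then obtain B where B: "B \<subseteq> A" "card B = n k"
      by (meson obtain_subset_with_card_n)
    then have "card (A - B) = card A - n k"
      using A by (simp add: card_Diff_subset finite_subset)
    then show ?thesis
      using B k l[of k] by (intro exI[of _ B]) auto
  qed
  then show ?thesis
    by (rule that)
qed

text \<open>
  Pass from \<open>A\<close> to the subset \<open>B\<close> of a good size and back. Either step costs at most a constant,
  and that constant is absorbed because a single coefficient of modulus 1 already forces the norm to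
  be bounded below.
\<close>

lemma uncond_const_coeff_bounded_gaps:
  assumes n: "gap_sequence n" "bounded_additive_gaps n"
    and V: "banach_space V" "is_basis V e" and u: "uncond_const_coeff (range n) V e"
  shows "uncond_const_coeff {1..} V e"
proof -
  interpret normed_space V
    using V by (simp add: banach_space_def)
  obtain L where L: "\<And>A :: nat set. finite A \<Longrightarrow>
      \<exists>B\<subseteq>A. (card B \<in> range n \<or> B = {}) \<and> card (A - B) \<le> L"
    using bounded_gaps_subset[OF n] by blast
  obtain K where K: "K > 0" and e: "range e \<subseteq> carrier V"
    and coeff: "\<And>a A i. finite A \<Longrightarrow> i \<in> A \<Longrightarrow> norm (a i) \<le> K * nrm V (lin_comb V e a A)"
    and up: "\<And>a A B M. finite A \<Longrightarrow> B \<subseteq> A \<Longrightarrow> (\<And>i. i \<in> A \<Longrightarrow> norm (a i) \<le> M) \<Longrightarrow>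
      nrm V (lin_comb V e a A) \<le> nrm V (lin_comb V e a B) + K * card (A - B) * M"
    and down: "\<And>a A B M. finite A \<Longrightarrow> B \<subseteq> A \<Longrightarrow> (\<And>i. i \<in> A \<Longrightarrow> norm (a i) \<le> M) \<Longrightarrow>
      nrm V (lin_comb V e a B) \<le> nrm V (lin_comb V e a A) + K * card (A - B) * M"
    using basis_estimates[OF V(2)] by metis
  obtain C where C: "C > 0" and uC: "\<forall>A \<epsilon> \<epsilon>'. finite A \<and> card A \<in> range n \<and>
      (\<forall>i\<in>A. norm (\<epsilon> i) = 1) \<and> (\<forall>i\<in>A. norm (\<epsilon>' i) = 1) \<longrightarrow>
      nrm V (lin_comb V e \<epsilon> A) \<le> C * nrm V (lin_comb V e \<epsilon>' A)"
    using u unfolding uncond_const_coeff_def by blast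
  have "nrm V (lin_comb V e \<epsilon> A) \<le> (C + (C + 1) * (K * L * K)) * nrm V (lin_comb V e \<epsilon>' A)"
    if A: "finite A" "card A \<in> {1..}"
      and \<epsilon>: "\<forall>i\<in>A. norm (\<epsilon> i) = 1" and \<epsilon>': "\<forall>i\<in>A. norm (\<epsilon>' i) = 1" for A \<epsilon> \<epsilon>'
  proof -
    obtain B where B: "B \<subseteq> A" "card B \<in> range n \<or> B = {}" "card (A - B) \<le> L"
      using L[OF A(1)] by blast
    obtain i where i: "i \<in> A"
      using A by fastforce
    have KL: "K * card (A - B) * 1 \<le> K * L"
      using K B by (simp add: mult_left_mono)
    have small: "K * L \<le> K * L * (K * nrm V (lin_comb V e \<epsilon>' A))"
      using mult_left_mono[of 1 "K * nrm V (lin_comb V e \<epsilon>' A)" "K * L"]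
        coeff[OF A(1) i, of \<epsilon>'] \<epsilon>' i K by simp
    have "nrm V (lin_comb V e \<epsilon> A) \<le> nrm V (lin_comb V e \<epsilon> B) + K * L"
      using up[OF A(1) B(1), of \<epsilon> 1] \<epsilon> KL by simp
    also have "nrm V (lin_comb V e \<epsilon> B) \<le> C * nrm V (lin_comb V e \<epsilon>' B)"
    proof (cases "B = {}")
      case False
      then show ?thesis
        using uC[rule_format, of B \<epsilon> \<epsilon>'] A B \<epsilon> \<epsilon>' by (auto simp: finite_subset)
    qed (simp add: lin_comb_empty nrm_zero)
    also have "nrm V (lin_comb V e \<epsilon>' B) \<le> nrm V (lin_comb V e \<epsilon>' A) + K * L"
      using down[OF A(1) B(1), of \<epsilon>' 1] \<epsilon>' KL by simp
    finally have "nrm V (lin_comb V e \<epsilon> A) \<le> C * nrm V (lin_comb V e \<epsilon>' A) + (C + 1) * (K * L)"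
      using C by (simp add: algebra_simps)
    also have "(C + 1) * (K * L) \<le> (C + 1) * (K * L * (K * nrm V (lin_comb V e \<epsilon>' A)))"
      using small C by (intro mult_left_mono) auto
    finally show ?thesis
      by (simp add: algebra_simps)
  qed
  moreover have "C + (C + 1) * (K * L * K) > 0"
    using C K by (intro add_pos_nonneg) auto
  ultimately show ?thesis
    unfolding uncond_const_coeff_def by blast
qed

text \<open>
  The same exchange as for signs. For the lower estimate the coefficients removed with \<open>A - B\<close>
  need not be comparable to the minimum, so they are bounded by the norm of the whole combination.
\<close>

lemma UL_property_bounded_gaps:
  fixes V :: "('k::{real_normed_field,euclidean_space}, 'u) nspace"
  assumes n: "gap_sequence n" "bounded_additive_gaps n"
    and V: "banach_space V" "is_basis V e" and u: "UL_property (range n) V e"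
  shows "UL_property {1..} V e"
proof -
  interpret normed_space V
    using V by (simp add: banach_space_def)
  obtain L where L: "\<And>A :: nat set. finite A \<Longrightarrow>
      \<exists>B\<subseteq>A. (card B \<in> range n \<or> B = {}) \<and> card (A - B) \<le> L"
    using bounded_gaps_subset[OF n] by blast
  obtain K where K: "K > 0" and e: "range e \<subseteq> carrier V"
    and coeff: "\<And>a A i. finite A \<Longrightarrow> i \<in> A \<Longrightarrow> norm (a i) \<le> K * nrm V (lin_comb V e a A)"
    and up: "\<And>a A B M. finite A \<Longrightarrow> B \<subseteq> A \<Longrightarrow> (\<And>i. i \<in> A \<Longrightarrow> norm (a i) \<le> M) \<Longrightarrow>
      nrm V (lin_comb V e a A) \<le> nrm V (lin_comb V e a B) + K * card (A - B) * M"
    and down: "\<And>a A B M. finite A \<Longrightarrow> B \<subseteq> A \<Longrightarrow> (\<And>i. i \<in> A \<Longrightarrow> norm (a i) \<le> M) \<Longrightarrow>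
      nrm V (lin_comb V e a B) \<le> nrm V (lin_comb V e a A) + K * card (A - B) * M"
    using basis_estimates[OF V(2)] by metis
  obtain C1 C2 where C: "C1 > 0" "C2 > 0" and uC: "\<forall>A a. finite A \<and> card A \<in> range n \<longrightarrow>
        1 / C1 * (MIN i\<in>A. norm (a i)) * nrm V (lin_comb V e (\<lambda>_. 1) A)
          \<le> nrm V (lin_comb V e a A) \<and>
        nrm V (lin_comb V e a A)
          \<le> C2 * (MAX i\<in>A. norm (a i)) * nrm V (lin_comb V e (\<lambda>_. 1) A)"
    using u unfolding UL_property_def by blast
  define D1 where "D1 = C1 * (1 + K * L * K) + K * L * K"
  define D2 where "D2 = C2 + (C2 + 1) * (K * L * K)"
  have D: "D1 > 0" "D2 > 0"
    unfolding D1_def D2_def using C K by (intro add_pos_nonneg mult_pos_pos; simp)+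
  have "1 / D1 * (MIN i\<in>A. norm (a i)) * nrm V (lin_comb V e (\<lambda>_. 1) A)
          \<le> nrm V (lin_comb V e a A) \<and>
        nrm V (lin_comb V e a A)
          \<le> D2 * (MAX i\<in>A. norm (a i)) * nrm V (lin_comb V e (\<lambda>_. 1) A)"
    if A: "finite A" "card A \<in> {1..}" for A and a :: "nat \<Rightarrow> 'k"
  proof -
    obtain B where B: "B \<subseteq> A" "card B \<in> range n \<or> B = {}" "card (A - B) \<le> L"
      using L[OF A(1)] by blast
    obtain i where i: "i \<in> A"
      using A by fastforce
    define M m where "M = (MAX i\<in>A. norm (a i))" and "m = (MIN i\<in>A. norm (a i))"
    let ?aA = "nrm V (lin_comb V e a A)" and ?aB = "nrm V (lin_comb V e a B)"
    let ?uA = "nrm V (lin_comb V e (\<lambda>_. 1) A)" and ?uB = "nrm V (lin_comb V e (\<lambda>_. 1) B)"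
    have M: "norm (a j) \<le> M" and m: "m \<le> norm (a j)" if "j \<in> A" for j
      using A that by (auto simp: M_def m_def)
    have m0: "m \<ge> 0"
      using A i unfolding m_def by (intro Min.boundedI) auto
    have M0: "M \<ge> 0"
      using M[OF i] norm_ge_zero[of "a i"] by linarith
    have KL: "K * card (A - B) * t \<le> K * L * t" if "t \<ge> 0" for t
      using K B that by (intro mult_right_mono mult_left_mono) auto
    have nn: "?aA \<ge> 0" "?aB \<ge> 0" "?uA \<ge> 0" "?uB \<ge> 0"
      by (simp_all add: nrm_nonneg lin_comb_closed e)
    have fin: "finite B"
      using A B by (simp add: finite_subset)
    have up_B: "?aB \<le> C2 * (M * ?uB)" and low_B: "m * ?uB \<le> C1 * ?aB"
    proof -
      show "?aB \<le> C2 * (M * ?uB)"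
      proof (cases "B = {}")
        case False
        then have "?aB \<le> C2 * (MAX i\<in>B. norm (a i)) * ?uB"
          using uC[rule_format, of B a] fin B by auto
        also have "\<dots> \<le> C2 * M * ?uB"
          using False fin B C M nn by (intro mult_right_mono mult_left_mono Max.boundedI) auto
        finally show ?thesis
          by (simp add: mult.assoc)
      qed (simp add: lin_comb_empty nrm_zero)
      show "m * ?uB \<le> C1 * ?aB"
      proof (cases "B = {}")
        case False
        have "m * ?uB \<le> (MIN i\<in>B. norm (a i)) * ?uB"
          using False fin B m nn by (intro mult_right_mono Min.boundedI) auto
        also have "\<dots> \<le> C1 * ?aB"
          using uC[rule_format, of B a] fin B C False by (simp add: field_simps)
        finally show ?thesis .
      qed (simp add: lin_comb_empty nrm_zero)
    qed
    have one: "1 \<le> K * ?uA"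
      using coeff[OF A(1) i, of "\<lambda>_. 1"] by simp
    have "?aA \<le> C2 * (M * (?uA + K * L)) + K * L * M"
    proof -
      have "?aA \<le> ?aB + K * L * M"
        using up[OF A(1) B(1), of a M] M KL[OF M0] by auto
      also have "?aB \<le> C2 * (M * (?uA + K * L))"
        using up_B down[OF A(1) B(1), of "\<lambda>_. 1" 1] KL[of 1] C M0
        by (intro order_trans[OF up_B] mult_left_mono) auto
      finally show ?thesis by simp
    qed
    also have "\<dots> = C2 * M * ?uA + (C2 + 1) * (K * L * M) * 1"
      by (simp add: algebra_simps)
    also have "\<dots> \<le> C2 * M * ?uA + (C2 + 1) * (K * L * M) * (K * ?uA)"
      using one C K M0 by (intro add_left_mono mult_left_mono) auto
    also have "\<dots> = D2 * M * ?uA"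
      by (simp add: D2_def algebra_simps)
    finally have upper: "?aA \<le> D2 * M * ?uA" .
    have m_le: "m \<le> K * ?aA"
      using m[OF i] coeff[OF A(1) i, of a] by linarith
    have "?aB \<le> ?aA + K * card (A - B) * (K * ?aA)"
      by (rule down[OF A(1) B(1) coeff[OF A(1)]])
    also have "\<dots> \<le> ?aA + K * L * (K * ?aA)"
      using KL[of "K * ?aA"] nn K by simp
    finally have aB: "?aB \<le> ?aA + K * L * (K * ?aA)" .
    have "m * ?uA \<le> m * (?uB + K * L)"
      using up[OF A(1) B(1), of "\<lambda>_. 1" 1] KL[of 1] m0 by (intro mult_left_mono) auto
    also have "\<dots> \<le> C1 * ?aB + K * L * m"
      using low_B by (simp add: algebra_simps)
    also have "\<dots> \<le> C1 * (?aA + K * L * (K * ?aA)) + K * L * (K * ?aA)"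
      using m_le aB C K by (intro add_mono mult_left_mono) auto
    also have "\<dots> = D1 * ?aA"
      by (simp add: D1_def algebra_simps)
    finally have "m * ?uA \<le> D1 * ?aA" .
    then have "1 / D1 * m * ?uA \<le> ?aA"
      using D by (simp add: field_simps)
    with upper show ?thesis
      by (simp add: M_def m_def)
  qed
  then show ?thesis
    unfolding UL_property_def
    by (intro exI[of _ D1] conjI[OF D(1)] exI[of _ D2] conjI[OF D(2)] allI impI) (elim conjE)
qed

lemma UL_property_imp_uncond_const_coeff:
  assumes u: "UL_property N V e" and N: "0 \<notin> N"
  shows "uncond_const_coeff N V e"
proof -
  obtain C1 C2 where C: "C1 > 0" "C2 > 0" and uC: "\<forall>A a. finite A \<and> card A \<in> N \<longrightarrow>
        1 / C1 * (MIN i\<in>A. norm (a i)) * nrm V (lin_comb V e (\<lambda>_. 1) A)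
          \<le> nrm V (lin_comb V e a A) \<and>
        nrm V (lin_comb V e a A)
          \<le> C2 * (MAX i\<in>A. norm (a i)) * nrm V (lin_comb V e (\<lambda>_. 1) A)"
    using u unfolding UL_property_def by blast
  have "nrm V (lin_comb V e \<epsilon> A) \<le> (C1 * C2) * nrm V (lin_comb V e \<epsilon>' A)"
    if A: "finite A" "card A \<in> N" "\<forall>i\<in>A. norm (\<epsilon> i) = 1" "\<forall>i\<in>A. norm (\<epsilon>' i) = 1" for A \<epsilon> \<epsilon>'
  proof -
    have "A \<noteq> {}"
      using A N by auto
    then have 1: "(\<lambda>i. norm (\<epsilon> i)) ` A = {1}" "(\<lambda>i. norm (\<epsilon>' i)) ` A = {1}"
      using A by auto
    have "nrm V (lin_comb V e \<epsilon> A) \<le> C2 * nrm V (lin_comb V e (\<lambda>_. 1) A)"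
      using uC[rule_format, OF conjI[OF A(1,2)], of \<epsilon>] by (simp add: 1)
    also have "nrm V (lin_comb V e (\<lambda>_. 1) A) \<le> C1 * nrm V (lin_comb V e \<epsilon>' A)"
      using uC[rule_format, OF conjI[OF A(1,2)], of \<epsilon>'] C by (simp add: 1 field_simps)
    finally show ?thesis
      using C by (simp add: algebra_simps)
  qed
  then show ?thesis
    unfolding uncond_const_coeff_def
    by (intro exI[of _ "C1 * C2"] conjI[OF mult_pos_pos[OF C]] allI impI) (elim conjE)
qed

section \<open>Banach spaces of scalar sequences given by seminorms\<close>

definition scale_seq :: "'k::real_normed_field \<Rightarrow> (nat \<Rightarrow> 'k) \<Rightarrow> nat \<Rightarrow> 'k" where
  "scale_seq a x = (\<lambda>i. a * x i)"

definition unit_seq :: "nat \<Rightarrow> nat \<Rightarrow> 'k::real_normed_field" where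
  "unit_seq i = (\<lambda>j. if j = i then 1 else 0)"

lemma scale_seq_apply [simp]: "scale_seq a x i = a * x i"
  by (simp add: scale_seq_def)

lemma unit_seq_apply [simp]: "unit_seq i j = (if j = i then 1 else 0)"
  by (simp add: unit_seq_def)

lemma scale_seq_simps [simp]:
  "scale_seq a (x + y) = scale_seq a x + scale_seq a y"
  "scale_seq (a + b) x = scale_seq a x + scale_seq b x"
  "scale_seq a (scale_seq b x) = scale_seq (a * b) x"
  "scale_seq 1 x = x" "scale_seq 0 x = 0" "scale_seq (-1) x = - x" "scale_seq a 0 = 0"
  by (auto simp: fun_eq_iff algebra_simps)

interpretation seq: vector_space scale_seq
  by unfold_locales auto

lemma independent_unit_seq: "seq.independent (range unit_seq :: (nat \<Rightarrow> 'k::real_normed_field) set)"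
  unfolding seq.independent_explicit_module
proof (intro allI impI)
  fix t u and v :: "nat \<Rightarrow> 'k"
  assume t: "finite t" "t \<subseteq> range unit_seq" and z: "(\<Sum>w\<in>t. scale_seq (u w) w) = 0" and v: "v \<in> t"
  obtain i where i: "v = unit_seq i"
    using t v by auto
  have sum_apply: "(\<Sum>w\<in>t. g w) j = (\<Sum>w\<in>t. g w j)" for g :: "(nat \<Rightarrow> 'k) \<Rightarrow> nat \<Rightarrow> 'k" and j
    using t(1) by (induction t) auto
  have "u w * w i = (if w = v then u v else 0)" if w: "w \<in> t" for w
  proof -
    obtain j where j: "w = unit_seq j"
      using t w by auto
    show ?thesis
    proof (cases "j = i")
      case False
      then have "w i \<noteq> v i"
        by (simp add: i j)
      then have "w \<noteq> v"
        by auto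
      then show ?thesis
        using False by (simp add: j)
    qed (simp add: i j)
  qed
  then have "(\<Sum>w\<in>t. scale_seq (u w) w) i = u v"
    using t v by (simp add: sum_apply)
  then show "u v = 0"
    using z by simp
qed

lemma infinite_range_unit_seq: "infinite (range unit_seq :: (nat \<Rightarrow> 'k::real_normed_field) set)"
proof (rule range_inj_infinite)
  show "inj (unit_seq :: nat \<Rightarrow> nat \<Rightarrow> 'k)"
    by (rule injI) (metis unit_seq_apply zero_neq_one)
qed

text \<open>
  Continuity of each seminorm under coordinatewise convergence is what makes the space complete:
  estimates that hold along a sequence pass to its coordinatewise limit. The coordinate
  seminorms make the coordinate functionals continuous.
\<close>

locale seminorm_family =
  fixes Phi :: "((nat \<Rightarrow> 'k::{real_normed_field,euclidean_space}) \<Rightarrow> real) set" and K :: real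
  assumes add_le: "p \<in> Phi \<Longrightarrow> p (x + y) \<le> p x + p y"
    and scale: "p \<in> Phi \<Longrightarrow> p (scale_seq a x) = norm a * p x"
    and unit_le: "p \<in> Phi \<Longrightarrow> p (unit_seq i) \<le> K"
    and pointwise: "p \<in> Phi \<Longrightarrow> (\<And>i. (\<lambda>m. Z m i) \<longlonglongrightarrow> x i) \<Longrightarrow> (\<lambda>m. p (Z m)) \<longlonglongrightarrow> p x"
    and coordinate: "(\<lambda>x. norm (x i)) \<in> Phi"
begin

text \<open>
  The closure of the finitely supported sequences, so that the unit vectors have dense span.
\<close>

definition seqs :: "(nat \<Rightarrow> 'k) set" where
  "seqs = {x. \<forall>\<epsilon>>0. \<exists>y. finite {i. y i \<noteq> 0} \<and> (\<forall>p\<in>Phi. p (x - y) \<le> \<epsilon>)}"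

definition gauge :: "(nat \<Rightarrow> 'k) \<Rightarrow> real" where
  "gauge x = (SUP p\<in>Phi. p x)"

lemma phi_zero: "p \<in> Phi \<Longrightarrow> p 0 = 0"
  using scale[of p 0 0] by simp

lemma phi_minus: "p \<in> Phi \<Longrightarrow> p (- x) = p x"
  using scale[of p "-1" x] by simp

lemma phi_diff_commute: "p \<in> Phi \<Longrightarrow> p (x - y) = p (y - x)"
  using phi_minus[of p "x - y"] by simp

lemma phi_nonneg: "p \<in> Phi \<Longrightarrow> 0 \<le> p x"
  using add_le[of p x "- x"] phi_minus[of p x] phi_zero[of p] by simp

lemma phi_finite_support:
  assumes p: "p \<in> Phi" and S: "finite S" "\<And>i. i \<notin> S \<Longrightarrow> y i = 0"
  shows "p y \<le> K * (\<Sum>i\<in>S. norm (y i))"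
  using S
proof (induction S arbitrary: y)
  case empty
  then have "y = 0"
    by (auto simp: fun_eq_iff)
  then have "p y = 0"
    by (simp only: phi_zero[OF p])
  then show ?case
    by simp
next
  case (insert i S)
  define z where "z = y(i := 0)"
  have y: "y = scale_seq (y i) (unit_seq i) + z"
    by (auto simp: z_def fun_eq_iff)
  have "p y \<le> p (scale_seq (y i) (unit_seq i)) + p z"
    by (subst y) (rule add_le[OF p])
  also have "p (scale_seq (y i) (unit_seq i)) \<le> norm (y i) * K"
    unfolding scale[OF p] by (intro mult_left_mono unit_le p) auto
  also have "p z \<le> K * (\<Sum>j\<in>S. norm (z j))"
    by (rule insert.IH) (use insert.prems in \<open>auto simp: z_def\<close>)
  also have "(\<Sum>j\<in>S. norm (z j)) = (\<Sum>j\<in>S. norm (y j))"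
    using insert.hyps by (intro sum.cong) (auto simp: z_def)
  finally show ?case
    using insert.hyps by (simp add: algebra_simps)
qed

lemma seqs_approx:
  assumes "x \<in> seqs" "\<epsilon> > 0"
  obtains y where "finite {i. y i \<noteq> 0}" "\<And>p. p \<in> Phi \<Longrightarrow> p (x - y) \<le> \<epsilon>"
  using assms by (auto simp: seqs_def)

lemma seqs_finite_support:
  assumes "finite {i. y i \<noteq> 0}"
  shows "y \<in> seqs"
  unfolding seqs_def using assms by (auto intro!: exI[of _ y] simp: phi_zero)

lemma seqs_add:
  assumes "x \<in> seqs" "y \<in> seqs"
  shows "x + y \<in> seqs"
  unfolding seqs_def
proof (intro CollectI allI impI)
  fix \<epsilon> :: real
  assume "\<epsilon> > 0"
  then have e: "\<epsilon> / 2 > 0"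
    by simp
  obtain x' where x': "finite {i. x' i \<noteq> 0}" "\<And>p. p \<in> Phi \<Longrightarrow> p (x - x') \<le> \<epsilon> / 2"
    using seqs_approx[OF assms(1) e] by blast
  obtain y' where y': "finite {i. y' i \<noteq> 0}" "\<And>p. p \<in> Phi \<Longrightarrow> p (y - y') \<le> \<epsilon> / 2"
    using seqs_approx[OF assms(2) e] by blast
  have "p (x + y - (x' + y')) \<le> \<epsilon>" if "p \<in> Phi" for p
    using add_le[OF that, of "x - x'" "y - y'"] x'(2)[OF that] y'(2)[OF that]
    by (simp add: algebra_simps)
  moreover have "finite {i. (x' + y') i \<noteq> 0}"
    by (rule finite_subset[OF _ finite_UnI[OF x'(1) y'(1)]]) auto
  ultimately show "\<exists>z. finite {i. z i \<noteq> 0} \<and> (\<forall>p\<in>Phi. p (x + y - z) \<le> \<epsilon>)"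
    by blast
qed

lemma seqs_scale:
  assumes "x \<in> seqs"
  shows "scale_seq a x \<in> seqs"
  unfolding seqs_def
proof (intro CollectI allI impI)
  fix \<epsilon> :: real
  assume e: "\<epsilon> > 0"
  have pos: "norm a + 1 > 0"
    by (rule add_nonneg_pos) auto
  obtain y where y: "finite {i. y i \<noteq> 0}" "\<And>p. p \<in> Phi \<Longrightarrow> p (x - y) \<le> \<epsilon> / (norm a + 1)"
    using seqs_approx[OF assms divide_pos_pos[OF e pos]] by blast
  have "p (scale_seq a x - scale_seq a y) \<le> \<epsilon>" if "p \<in> Phi" for p
  proof -
    have "scale_seq a x - scale_seq a y = scale_seq a (x - y)"
      by (auto simp: fun_eq_iff algebra_simps)
    then have "p (scale_seq a x - scale_seq a y) = norm a * p (x - y)"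
      by (simp add: scale that)
    also have "\<dots> \<le> (norm a + 1) * (\<epsilon> / (norm a + 1))"
      using y(2)[OF that] phi_nonneg[OF that] by (intro mult_mono) auto
    also have "\<dots> = \<epsilon>"
      using pos by simp
    finally show ?thesis .
  qed
  moreover have "finite {i. scale_seq a y i \<noteq> 0}"
    by (rule finite_subset[OF _ y(1)]) auto
  ultimately show "\<exists>z. finite {i. z i \<noteq> 0} \<and> (\<forall>p\<in>Phi. p (scale_seq a x - z) \<le> \<epsilon>)"
    by blast
qed

lemma seqs_zero: "0 \<in> seqs"
  by (rule seqs_finite_support) auto

lemma seqs_uminus: "x \<in> seqs \<Longrightarrow> - x \<in> seqs"
  using seqs_scale[of x "-1"] by simp

lemma seqs_diff: "x \<in> seqs \<Longrightarrow> y \<in> seqs \<Longrightarrow> x - y \<in> seqs"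
  using seqs_add[of x "- y"] seqs_uminus[of y] by simp

lemma seqs_unit: "unit_seq i \<in> seqs"
  by (rule seqs_finite_support) auto

lemma seqs_bdd:
  assumes "x \<in> seqs"
  shows "bdd_above ((\<lambda>p. p x) ` Phi)"
proof -
  obtain y where y: "finite {i. y i \<noteq> 0}" "\<And>p. p \<in> Phi \<Longrightarrow> p (x - y) \<le> 1"
    using seqs_approx[OF assms, of 1] by auto
  have "p x \<le> 1 + K * (\<Sum>i\<in>{i. y i \<noteq> 0}. norm (y i))" if "p \<in> Phi" for p
    using add_le[OF that, of "x - y" y] y(2)[OF that] phi_finite_support[OF that y(1), of y] by simp
  then show ?thesis
    unfolding bdd_above_def by blast
qed

lemma phi_le_gauge: "x \<in> seqs \<Longrightarrow> p \<in> Phi \<Longrightarrow> p x \<le> gauge x"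
  unfolding gauge_def by (rule cSUP_upper[OF _ seqs_bdd])

lemma gauge_le: "(\<And>p. p \<in> Phi \<Longrightarrow> p x \<le> B) \<Longrightarrow> gauge x \<le> B"
  unfolding gauge_def by (rule cSUP_least) (use coordinate in auto)

lemma coordinate_le_gauge: "x \<in> seqs \<Longrightarrow> norm (x i) \<le> gauge x"
  using phi_le_gauge[OF _ coordinate] .

lemma gauge_nonneg: "x \<in> seqs \<Longrightarrow> 0 \<le> gauge x"
  using coordinate_le_gauge[of x 0] norm_ge_zero[of "x 0"] by linarith

lemma gauge_triangle:
  assumes x: "x \<in> seqs" and y: "y \<in> seqs"
  shows "gauge (x + y) \<le> gauge x + gauge y"
proof (rule gauge_le)
  fix p assume p: "p \<in> Phi"
  show "p (x + y) \<le> gauge x + gauge y"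
    using add_le[OF p, of x y] phi_le_gauge[OF x p] phi_le_gauge[OF y p] by linarith
qed

lemma gauge_eq_zero: "x \<in> seqs \<Longrightarrow> gauge x = 0 \<longleftrightarrow> x = 0"
proof
  assume "x \<in> seqs" "gauge x = 0"
  then have "x i = 0" for i
    using coordinate_le_gauge[of x i] by simp
  then show "x = 0"
    by (auto simp: fun_eq_iff)
next
  assume "x = 0"
  then have "gauge x \<le> 0"
    by (intro gauge_le) (simp add: phi_zero)
  then show "gauge x = 0"
    using gauge_nonneg[OF seqs_zero] \<open>x = 0\<close> by simp
qed

lemma gauge_scale:
  assumes "x \<in> seqs"
  shows "gauge (scale_seq a x) = norm a * gauge x"
proof (cases "a = 0")
  case True
  then show ?thesis
    using gauge_eq_zero[OF seqs_zero] by simp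
next
  case False
  have le: "gauge (scale_seq b y) \<le> norm b * gauge y" if "y \<in> seqs" for b y
    by (rule gauge_le) (simp add: scale mult_left_mono phi_le_gauge that)
  have "gauge (scale_seq (1 / a) (scale_seq a x)) \<le> norm (1 / a) * gauge (scale_seq a x)"
    by (rule le[OF seqs_scale[OF assms]])
  then have "norm a * gauge x \<le> gauge (scale_seq a x)"
    using False by (simp add: norm_divide field_simps)
  with le[OF assms] show ?thesis
    by (simp add: antisym)
qed

lemma gauge_unit: "1 \<le> gauge (unit_seq i)" "gauge (unit_seq i) \<le> K"
  using coordinate_le_gauge[OF seqs_unit, of i i] by (auto intro: gauge_le unit_le)

end

text \<open>
  The carrier has to be a subset of a prescribed type. The space is therefore transported
  along an injection \<open>h\<close> defined on all sequences.
\<close>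

locale realized_seminorm_family = seminorm_family Phi K
  for Phi :: "((nat \<Rightarrow> 'k::{real_normed_field,euclidean_space}) \<Rightarrow> real) set" and K +
  fixes h :: "(nat \<Rightarrow> 'k) \<Rightarrow> 'u"
  assumes inj_h: "inj h"
begin

abbreviation seq_of :: "'u \<Rightarrow> nat \<Rightarrow> 'k" where
  "seq_of \<equiv> inv_into UNIV h"

definition V :: "('k, 'u) nspace" where
  "V = \<lparr>carrier = h ` seqs, mult = (\<lambda>u v. u), one = h 0, zero = h 0,
        add = (\<lambda>u v. h (seq_of u + seq_of v)), smult = (\<lambda>a u. h (scale_seq a (seq_of u))),
        nrm = (\<lambda>u. gauge (seq_of u))\<rparr>"

lemma seq_of_h [simp]: "seq_of (h x) = x"
  by (rule inv_f_f[OF inj_h])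

lemma h_eq_iff [simp]: "h x = h y \<longleftrightarrow> x = y"
  using inj_h by (auto simp: inj_def)

lemma carrier_V: "carrier V = h ` seqs"
  by (simp add: V_def)

lemma h_in_carrier [simp]: "h x \<in> carrier V \<longleftrightarrow> x \<in> seqs"
  by (auto simp: carrier_V)

lemma V_simps [simp]:
  "\<zero>\<^bsub>V\<^esub> = h 0" "h x \<oplus>\<^bsub>V\<^esub> h y = h (x + y)"
  "a \<odot>\<^bsub>V\<^esub> h x = h (scale_seq a x)" "nrm V (h x) = gauge x"
  by (simp_all add: V_def)

sublocale normed_space V
proof (intro normed_space.intro normed_space_axioms.intro)
  show "Module.module (ring_of_type_algebra :: 'k ring) V"
  proof (rule Module.moduleI[OF cring_from_type_algebra abelian_groupI])
    fix u assume "u \<in> carrier V"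
    then obtain x where "u = h x" "x \<in> seqs"
      by (auto simp: carrier_V)
    then show "\<exists>v\<in>carrier V. v \<oplus>\<^bsub>V\<^esub> u = \<zero>\<^bsub>V\<^esub>"
      by (intro bexI[of _ "h (- x)"]) (auto simp: seqs_uminus)
  qed (auto simp: carrier_V seqs_add seqs_zero seqs_scale ring_of_type_algebra_def add.assoc add.commute)
qed (auto simp: carrier_V gauge_eq_zero gauge_scale gauge_triangle)

lemma V_uminus: "x \<in> seqs \<Longrightarrow> \<ominus>\<^bsub>V\<^esub> h x = h (- x)"
  by (rule M.minus_equality) (auto simp: seqs_uminus)

lemma ndist_h: "x \<in> seqs \<Longrightarrow> y \<in> seqs \<Longrightarrow> ndist V (h x) (h y) = gauge (x - y)"
  by (simp add: ndist_def a_minus_def V_uminus)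

text \<open>
  The seminorms, being continuous for coordinatewise convergence, carry the Cauchy estimate over to
  the coordinatewise limit, uniformly in the seminorm; the limit then inherits approximability by
  finitely supported sequences.
\<close>

lemma complete: "mcomplete"
  unfolding mcomplete_def
proof (intro allI impI)
  fix \<sigma>
  assume cauchy: "MCauchy \<sigma>"
  then have "range \<sigma> \<subseteq> carrier V"
    unfolding MCauchy_def by (rule conjunct1)
  then have "\<forall>m. \<exists>x\<in>seqs. \<sigma> m = h x"
    by (auto simp: carrier_V)
  then obtain \<tau> where \<tau>: "\<And>m. \<tau> m \<in> seqs" "\<And>m. \<sigma> m = h (\<tau> m)"
    by metis
  have "\<exists>M. \<forall>m\<ge>M. \<forall>q\<ge>M. gauge (\<tau> m - \<tau> q) < \<epsilon>" if "\<epsilon> > 0" for \<epsilon>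
  proof -
    have "\<exists>M. \<forall>m q. M \<le> m \<longrightarrow> M \<le> q \<longrightarrow> ndist V (\<sigma> m) (\<sigma> q) < \<epsilon>"
      using cauchy that unfolding MCauchy_def by blast
    then show ?thesis
      by (simp add: \<tau> ndist_h)
  qed
  then obtain M where M: "\<And>\<epsilon> m q. \<epsilon> > 0 \<Longrightarrow> m \<ge> M \<epsilon> \<Longrightarrow> q \<ge> M \<epsilon> \<Longrightarrow> gauge (\<tau> m - \<tau> q) < \<epsilon>"
    by metis
  have "Cauchy (\<lambda>m. \<tau> m i)" for i
  proof (rule metric_CauchyI)
    fix \<epsilon> :: real assume e: "\<epsilon> > 0"
    have "dist (\<tau> m i) (\<tau> q i) < \<epsilon>" if "m \<ge> M \<epsilon>" "q \<ge> M \<epsilon>" for m q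
      using M[OF e that] coordinate_le_gauge[OF seqs_diff[OF \<tau>(1)[of m] \<tau>(1)[of q]], of i]
      by (simp add: dist_norm)
    then show "\<exists>M. \<forall>m\<ge>M. \<forall>q\<ge>M. dist (\<tau> m i) (\<tau> q i) < \<epsilon>"
      by blast
  qed
  then have "\<forall>i. \<exists>l. (\<lambda>m. \<tau> m i) \<longlonglongrightarrow> l"
    by (simp add: Cauchy_convergent_iff convergent_def)
  then obtain x where x: "\<And>i. (\<lambda>m. \<tau> m i) \<longlonglongrightarrow> x i"
    by metis
  have close: "p (\<tau> m - x) \<le> \<epsilon>" if e: "\<epsilon> > 0" and m: "m \<ge> M \<epsilon>" and p: "p \<in> Phi" for \<epsilon> m p
  proof (rule LIMSEQ_le_const2)
    show "(\<lambda>q. p (\<tau> m - \<tau> q)) \<longlonglongrightarrow> p (\<tau> m - x)"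
      by (rule pointwise[OF p]) (auto intro!: tendsto_intros x)
    have "p (\<tau> m - \<tau> q) \<le> \<epsilon>" if "q \<ge> M \<epsilon>" for q
      using M[OF e m that] phi_le_gauge[OF seqs_diff[OF \<tau>(1) \<tau>(1)] p, of m q] by linarith
    then show "\<exists>P. \<forall>q\<ge>P. p (\<tau> m - \<tau> q) \<le> \<epsilon>"
      by blast
  qed
  have xX: "x \<in> seqs"
    unfolding seqs_def
  proof (intro CollectI allI impI)
    fix \<epsilon> :: real assume "\<epsilon> > 0"
    then have e: "\<epsilon> / 2 > 0"
      by simp
    define m where "m = M (\<epsilon> / 2)"
    obtain y where y: "finite {i. y i \<noteq> 0}" "\<And>p. p \<in> Phi \<Longrightarrow> p (\<tau> m - y) \<le> \<epsilon> / 2"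
      using seqs_approx[OF \<tau>(1) e] by metis
    have "p (x - y) \<le> \<epsilon>" if "p \<in> Phi" for p
      using add_le[OF that, of "x - \<tau> m" "\<tau> m - y"] y(2)[OF that] close[OF e _ that, of m]
        phi_diff_commute[OF that, of x "\<tau> m"] by (simp add: m_def)
    then show "\<exists>y. finite {i. y i \<noteq> 0} \<and> (\<forall>p\<in>Phi. p (x - y) \<le> \<epsilon>)"
      using y(1) by blast
  qed
  have "gauge (\<tau> m - x) < \<epsilon>" if e: "\<epsilon> > 0" and m: "m \<ge> M (\<epsilon> / 2)" for \<epsilon> m
  proof -
    have "gauge (\<tau> m - x) \<le> \<epsilon> / 2"
      using e by (intro gauge_le close m) auto
    then show ?thesis
      using e by simp
  qed
  then have "limitin mtopology \<sigma> (h x) sequentially"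
    unfolding limit_metric_sequentially using xX \<tau>(1) by (auto simp: \<tau>(2) ndist_h)
  then show "\<exists>l. limitin mtopology \<sigma> l sequentially"
    by blast
qed

lemma denseI:
  assumes D: "D \<subseteq> seqs" and approx: "\<And>x \<epsilon>. x \<in> seqs \<Longrightarrow> \<epsilon> > 0 \<Longrightarrow> \<exists>y\<in>D. \<forall>p\<in>Phi. p (x - y) \<le> \<epsilon>"
  shows "ntopology V closure_of (h ` D) = carrier V"
proof -
  have "\<exists>v\<in>h ` D. v \<in> mball (h x) r" if x: "x \<in> seqs" and r: "r > 0" for x r
  proof -
    obtain y where y: "y \<in> D" "\<forall>p\<in>Phi. p (x - y) \<le> r / 2"
      using approx[OF x, of "r / 2"] r by auto
    then have "gauge (x - y) \<le> r / 2"
      by (intro gauge_le) auto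
    then show ?thesis
      using y D x r by (intro bexI[of _ "h y"]) (auto simp: in_mball ndist_h subset_iff)
  qed
  then show ?thesis
    unfolding ntopology_def metric_closure_of by (auto simp: carrier_V)
qed

text \<open>
  Finitely supported sequences with values in a countable dense set of scalars, listed by
  their initial segments.
\<close>

lemma separable: "separable_space (ntopology V)"
proof -
  obtain D :: "'k set" where D: "countable D" "\<And>U. open U \<Longrightarrow> U \<noteq> {} \<Longrightarrow> \<exists>d\<in>D. d \<in> U"
    by (rule countable_dense_setE) blast
  define F where "F = (\<lambda>l i. if i < length l then l ! i else 0 :: 'k) ` lists D"
  have fin: "finite {i. (if i < length l then l ! i else 0) \<noteq> 0}" for l :: "'k list"
    by (rule finite_subset[of _ "{..<length l}"]) auto
  have FX: "F \<subseteq> seqs"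
    unfolding F_def by (auto intro: seqs_finite_support[OF fin])
  have "ntopology V closure_of (h ` F) = carrier V"
  proof (rule denseI[OF FX])
    fix x :: "nat \<Rightarrow> 'k" and \<epsilon> :: real
    assume x: "x \<in> seqs" and e: "\<epsilon> > 0"
    obtain y where y: "finite {i. y i \<noteq> 0}" "\<And>p. p \<in> Phi \<Longrightarrow> p (x - y) \<le> \<epsilon> / 2"
      using seqs_approx[OF x, of "\<epsilon> / 2"] e by auto
    obtain m where m: "\<And>i. y i \<noteq> 0 \<Longrightarrow> i < m"
      using y(1) by (auto simp: finite_nat_set_iff_bounded)
    have Kpos: "K > 0"
      using gauge_unit[of 0] by linarith
    define \<delta> where "\<delta> = \<epsilon> / 2 / (K * (real m + 1))"
    have d: "\<delta> > 0"
      using e Kpos by (simp add: \<delta>_def)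
    have "\<exists>c\<in>D. norm (y i - c) < \<delta>" for i
      using D(2)[of "ball (y i) \<delta>"] d by (auto simp: dist_norm)
    then obtain c where c: "\<And>i. c i \<in> D" "\<And>i. norm (y i - c i) < \<delta>"
      by metis
    define z where "z = (\<lambda>i. if i < m then c i else 0)"
    have zF: "z \<in> F"
      unfolding F_def
      by (rule image_eqI[of _ _ "map c [0..<m]"]) (auto simp: z_def fun_eq_iff c(1))
    have "p (x - z) \<le> \<epsilon>" if p: "p \<in> Phi" for p
    proof -
      have supp: "(y - z) i = 0" if "i \<notin> {..<m}" for i
        using m that by (auto simp: z_def)
      have "p (y - z) \<le> K * (\<Sum>i<m. norm ((y - z) i))"
        by (rule phi_finite_support[OF p finite_lessThan supp])
      also have "\<dots> \<le> K * (\<Sum>i<m. \<delta>)"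
        using Kpos c(2) by (intro mult_left_mono sum_mono) (auto simp: z_def intro: less_imp_le)
      also have "\<dots> \<le> (K * (real m + 1)) * \<delta>"
        using Kpos d by (simp add: algebra_simps)
      also have "\<dots> = \<epsilon> / 2"
        unfolding \<delta>_def
        by (subst times_divide_eq_right, rule nonzero_mult_div_cancel_left)
          (use mult_pos_pos[OF Kpos, of "real m + 1"] in auto)
      finally show ?thesis
        using add_le[OF p, of "x - y" "y - z"] y(2)[OF p] by simp
    qed
    then show "\<exists>z\<in>F. \<forall>p\<in>Phi. p (x - z) \<le> \<epsilon>"
      using zF by blast
  qed
  moreover have "countable (h ` F)"
    unfolding F_def using D(1) by simp
  moreover have "h ` F \<subseteq> topspace (ntopology V)"
    using FX by (auto simp: ntopology_def)
  ultimately show ?thesis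
    unfolding separable_space_def by (auto simp: ntopology_def intro!: exI[of _ "h ` F"])
qed

text \<open>
  The unit vectors are infinitely many linearly independent elements, so by the Steinitz exchange
  theorem no finite set spans them.
\<close>

lemma infinite_dimensional:
  assumes S: "finite S" "S \<subseteq> carrier V" and span: "lin_span V S = carrier V"
  shows False
proof -
  let ?T = "seq_of ` S"
  have sum: "seq_of (\<Oplus>\<^bsub>V\<^esub>v\<in>A. a v \<odot>\<^bsub>V\<^esub> v) \<in> seq.span ?T \<and> (\<Oplus>\<^bsub>V\<^esub>v\<in>A. a v \<odot>\<^bsub>V\<^esub> v) \<in> carrier V"
    if "finite A" "A \<subseteq> S" for A a
    using that
  proof (induction A)
    case empty
    have "(\<Oplus>\<^bsub>V\<^esub>v\<in>{}. a v \<odot>\<^bsub>V\<^esub> v) = h 0"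
      by (simp only: M.finsum_empty V_simps)
    then show ?case
      by (simp only: seq_of_h h_in_carrier seqs_zero seq.span_zero)
  next
    case (insert v A)
    then have "v \<in> carrier V"
      using S by auto
    then obtain x where x: "v = h x" "x \<in> seqs"
      by (auto simp: carrier_V)
    obtain y where y: "(\<Oplus>\<^bsub>V\<^esub>v\<in>A. a v \<odot>\<^bsub>V\<^esub> v) = h y" "y \<in> seqs" "y \<in> seq.span ?T"
    proof -
      have IH: "seq_of (\<Oplus>\<^bsub>V\<^esub>v\<in>A. a v \<odot>\<^bsub>V\<^esub> v) \<in> seq.span ?T" "(\<Oplus>\<^bsub>V\<^esub>v\<in>A. a v \<odot>\<^bsub>V\<^esub> v) \<in> carrier V"
        using insert.IH insert.prems by blast+
      then obtain y where "(\<Oplus>\<^bsub>V\<^esub>v\<in>A. a v \<odot>\<^bsub>V\<^esub> v) = h y" "y \<in> seqs"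
        unfolding carrier_V by blast
      then show ?thesis
        using that IH(1) by (simp only: seq_of_h)
    qed
    have xT: "x \<in> ?T"
      using x insert.prems by (auto intro!: image_eqI[of _ _ v])
    have "(\<Oplus>\<^bsub>V\<^esub>v\<in>insert v A. a v \<odot>\<^bsub>V\<^esub> v) = a v \<odot>\<^bsub>V\<^esub> v \<oplus>\<^bsub>V\<^esub> (\<Oplus>\<^bsub>V\<^esub>v\<in>A. a v \<odot>\<^bsub>V\<^esub> v)"
      by (rule M.finsum_insert) (use insert S \<open>v \<in> carrier V\<close> in \<open>auto simp del: V_simps\<close>)
    also have "\<dots> = h (scale_seq (a v) x + y)"
      by (simp add: x y)
    finally have "(\<Oplus>\<^bsub>V\<^esub>v\<in>insert v A. a v \<odot>\<^bsub>V\<^esub> v) = h (scale_seq (a v) x + y)" .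
    moreover have "scale_seq (a v) x + y \<in> seq.span ?T"
      by (intro seq.span_add seq.span_scale seq.span_base xT y)
    ultimately show ?case
      by (simp only: seq_of_h h_in_carrier seqs_add seqs_scale x y simp_thms)
  qed
  have "range unit_seq \<subseteq> seq.span ?T"
  proof clarify
    fix i
    have "h (unit_seq i) \<in> lin_span V S"
      using span seqs_unit by simp
    then obtain A a where "h (unit_seq i) = (\<Oplus>\<^bsub>V\<^esub>v\<in>A. a v \<odot>\<^bsub>V\<^esub> v)" "finite A" "A \<subseteq> S"
      unfolding lin_span_def by auto
    then show "unit_seq i \<in> seq.span ?T"
      using sum[of A a] by (metis seq_of_h)
  qed
  then show False
    using seq.independent_span_bound[OF _ independent_unit_seq] S(1) infinite_range_unit_seq
    by blast
qed

lemma banach: "banach_space V"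
  unfolding banach_space_def
  using normed_space_axioms complete separable infinite_dimensional by blast

abbreviation e :: "nat \<Rightarrow> 'u" where
  "e i \<equiv> h (unit_seq i)"

lemma e_carrier: "range e \<subseteq> carrier V"
  using seqs_unit by auto

lemma lin_comb_h:
  assumes "finite A"
  shows "lin_comb V e a A = h (\<lambda>i. if i \<in> A then a i else 0)"
  using assms
proof (induction A)
  case empty
  have "(\<lambda>i. if i \<in> {} then a i else 0) = 0"
    by (auto simp: fun_eq_iff)
  then show ?case
    by (simp only: lin_comb_empty V_simps)
next
  case (insert i A)
  have "lin_comb V e a (insert i A) = a i \<odot>\<^bsub>V\<^esub> e i \<oplus>\<^bsub>V\<^esub> lin_comb V e a A"
    by (rule lin_comb_insert[OF e_carrier insert.hyps])
  also have "\<dots> = h (scale_seq (a i) (unit_seq i) + (\<lambda>j. if j \<in> A then a j else 0))"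
    unfolding insert.IH by (simp only: V_simps)
  also have "scale_seq (a i) (unit_seq i) + (\<lambda>j. if j \<in> A then a j else 0)
      = (\<lambda>j. if j \<in> insert i A then a j else 0)"
    using insert.hyps by (auto simp: fun_eq_iff)
  finally show ?case .
qed

lemma finite_support_in_span:
  assumes "finite {i. y i \<noteq> 0}"
  shows "h y \<in> lin_span V (range e)"
proof -
  let ?S = "{i. y i \<noteq> 0}"
  have inj: "inj_on e ?S"
    by (rule inj_onI) (metis h_eq_iff unit_seq_apply zero_neq_one)
  have "(\<Oplus>\<^bsub>V\<^esub>v\<in>e ` ?S. y (the_inv_into ?S e v) \<odot>\<^bsub>V\<^esub> v)
      = (\<Oplus>\<^bsub>V\<^esub>i\<in>?S. y (the_inv_into ?S e (e i)) \<odot>\<^bsub>V\<^esub> e i)"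
    by (rule M.finsum_reindex[OF _ inj]) (auto simp: seqs_scale seqs_unit)
  also have "\<dots> = lin_comb V e y ?S"
    unfolding lin_comb_def
    by (rule M.finsum_cong') (auto simp: seqs_scale seqs_unit the_inv_into_f_f[OF inj])
  also have "\<dots> = h y"
    unfolding lin_comb_h[OF assms] by (simp add: fun_eq_iff)
  finally show ?thesis
    unfolding lin_span_def using assms by (intro CollectI exI conjI) (auto intro: sym)
qed

lemma span_dense: "ntopology V closure_of lin_span V (range e) = carrier V"
proof -
  let ?F = "{y. finite {i. y i \<noteq> 0}}"
  have "ntopology V closure_of (h ` ?F) = carrier V"
  proof (rule denseI)
    show "?F \<subseteq> seqs"
      using seqs_finite_support by auto
    show "\<exists>y\<in>?F. \<forall>p\<in>Phi. p (x - y) \<le> \<epsilon>" if "x \<in> seqs" "\<epsilon> > 0" for x \<epsilon>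
      using that unfolding seqs_def by blast
  qed
  moreover have "h ` ?F \<subseteq> lin_span V (range e)"
    using finite_support_in_span by auto
  then have "ntopology V closure_of (h ` ?F) \<subseteq> ntopology V closure_of lin_span V (range e)"
    by (rule closure_of_mono)
  moreover have "ntopology V closure_of lin_span V (range e) \<subseteq> carrier V"
    using closure_of_subset_topspace[of "ntopology V"] by (simp add: ntopology_def)
  ultimately show ?thesis
    by auto
qed

lemma coordinate_dual: "(\<lambda>u. seq_of u i) \<in> dual V"
proof -
  have "openin mtopology {u \<in> carrier V. seq_of u i \<in> U}" if U: "open U" for U :: "'k set"
    unfolding openin_mtopology
  proof (intro conjI allI impI)
    fix u assume u: "u \<in> {u \<in> carrier V. seq_of u i \<in> U}"
    then obtain x where x: "u = h x" "x \<in> seqs" "x i \<in> U"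
      by (auto simp: carrier_V)
    obtain r where r: "r > 0" "ball (x i) r \<subseteq> U"
      using U x(3) by (meson openE)
    have "v \<in> {u \<in> carrier V. seq_of u i \<in> U}" if v: "v \<in> mball u r" for v
    proof -
      obtain y where y: "v = h y" "y \<in> seqs" "gauge (x - y) < r"
      proof -
        have "v \<in> carrier V" "ndist V u v < r"
          using v by (auto simp: in_mball)
        then show ?thesis
          using x that by (auto simp: carrier_V ndist_h)
      qed
      have "norm ((x - y) i) \<le> gauge (x - y)"
        by (intro coordinate_le_gauge seqs_diff x y)
      then have "y i \<in> ball (x i) r"
        using y by (simp add: dist_norm)
      then show ?thesis
        using y r by auto
    qed
    then show "\<exists>r>0. mball u r \<subseteq> {u \<in> carrier V. seq_of u i \<in> U}"
      using r(1) by blast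
  qed auto
  then have "continuous_map (ntopology V) euclidean (\<lambda>u. seq_of u i)"
    unfolding continuous_map_def ntopology_def by (auto simp: open_openin[symmetric])
  then show ?thesis
    unfolding dual_def by (auto simp: carrier_V)
qed

lemma coordinate_dual_nrm:
  "1 / K \<le> dual_nrm V (\<lambda>u. seq_of u i)" "dual_nrm V (\<lambda>u. seq_of u i) \<le> 1"
proof -
  let ?B = "{u \<in> carrier V. nrm V u \<le> 1}"
  have Kpos: "K > 0"
    using gauge_unit[of 0] by linarith
  define u where "u = h (scale_seq (of_real (1 / K)) (unit_seq i))"
  have "gauge (scale_seq (of_real (1 / K)) (unit_seq i)) \<le> 1"
    using gauge_unit[of i] Kpos by (simp add: gauge_scale seqs_unit norm_divide)
  then have "u \<in> ?B"
    by (auto simp: u_def seqs_scale seqs_unit)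
  then have "norm (seq_of u i) \<le> dual_nrm V (\<lambda>u. seq_of u i)"
    unfolding dual_nrm_def by (rule cSUP_upper) (rule dual_bounded[OF coordinate_dual])
  then show "1 / K \<le> dual_nrm V (\<lambda>u. seq_of u i)"
    using Kpos by (simp add: u_def norm_divide)
  show "dual_nrm V (\<lambda>u. seq_of u i) \<le> 1"
    unfolding dual_nrm_def
  proof (rule cSUP_least)
    show "?B \<noteq> {}"
      using \<open>u \<in> ?B\<close> by blast
    show "norm (seq_of v i) \<le> 1" if "v \<in> ?B" for v
      using that coordinate_le_gauge[of "seq_of v" i] by (auto simp: carrier_V)
  qed
qed

text \<open>
  The biorthogonal functionals are the coordinates, and a sequence with vanishing coordinates is zero.
\<close>

lemma markushevich: "markushevich_basis V e"
proof -
  have K1: "K \<ge> 1"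
    using gauge_unit[of 0] by linarith
  have "1 / K \<le> (INF i. min (nrm V (e i)) (dual_nrm V (\<lambda>u. seq_of u i)))"
    by (rule cINF_greatest) (use gauge_unit coordinate_dual_nrm K1 in \<open>auto intro: order_trans[of _ 1]\<close>)
  then have "0 < (INF i. min (nrm V (e i)) (dual_nrm V (\<lambda>u. seq_of u i)))"
    using K1 by (auto intro: less_le_trans[of 0 "1 / K"])
  moreover have "max (nrm V (e i)) (dual_nrm V (\<lambda>u. seq_of u i)) \<le> K" for i
    using gauge_unit[of i] coordinate_dual_nrm[of i] K1 by auto
  then have "bdd_above (range (\<lambda>i. max (nrm V (e i)) (dual_nrm V (\<lambda>u. seq_of u i))))"
    unfolding bdd_above_def by blast
  ultimately have "basis_pair V e (\<lambda>i u. seq_of u i)"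
    unfolding basis_pair_def using e_carrier span_dense coordinate_dual by auto
  moreover have "\<forall>u\<in>carrier V. (\<forall>i. seq_of u i = 0) \<longrightarrow> u = \<zero>\<^bsub>V\<^esub>"
    by (auto simp: carrier_V fun_eq_iff)
  ultimately show ?thesis
    unfolding markushevich_basis_def by blast
qed

end

section \<open>Seminorms that are blind to one set of a missing size\<close>

text \<open>
  In a second countable \<open>T\<^sub>1\<close> space, a point is determined by the indices of the basic open sets
  that contain it, and a sequence by the indices for all of its terms.
\<close>

lemma sequences_inject:
  assumes "(UNIV :: real set) \<lesssim> (UNIV :: 'u set)"
  obtains h :: "(nat \<Rightarrow> 'k::{t1_space,second_countable_topology}) \<Rightarrow> 'u" where "inj h"
proof -
  obtain B :: "'k set set" where B: "countable B" "topological_basis B"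
    using ex_countable_basis by blast
  define code where "code = (\<lambda>x :: nat \<Rightarrow> 'k. {prod_encode (i, j) | i j. x i \<in> from_nat_into B j})"
  have "code x \<noteq> code y" if "x i \<noteq> y i" for x y i
  proof -
    obtain U where U: "open U" "x i \<in> U" "y i \<notin> U"
      using separation_t1[of "x i" "y i"] \<open>x i \<noteq> y i\<close> by blast
    obtain b where b: "b \<in> B" "x i \<in> b" "b \<subseteq> U"
      using topological_basisE[OF B(2) U(1,2)] by blast
    obtain j where "from_nat_into B j = b"
      using from_nat_into_surj[OF B(1) b(1)] by blast
    then have "prod_encode (i, j) \<in> code x" "prod_encode (i, j) \<notin> code y"
      using b U by (auto simp: code_def)
    then show ?thesis
      by blast
  qed
  then have "inj code"
    by (auto simp: inj_def fun_eq_iff)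
  moreover have "(UNIV :: nat set set) \<lesssim> (UNIV :: 'u set)"
    using assms nat_sets_eqpoll_reals eqpoll_imp_lepoll lepoll_trans by blast
  then obtain g :: "nat set \<Rightarrow> 'u" where "inj g"
    by (auto simp: lepoll_def)
  ultimately show ?thesis
    using that[of "g \<circ> code"] inj_compose by blast
qed

text \<open>
  The blocks \<open>{s k..<s (Suc k)}\<close> are consecutive, and \<open>d k\<close> is the number of coordinates
  that the \<open>k\<close>-th seminorm may add up. The assumption \<open>gap\<close> says that the length of
  a block lies deep inside a gap of \<open>N\<close>: a set of a size in \<open>N\<close> either misses at least \<open>d k\<close>
  elements of the block or has at least \<open>d k\<close> elements beyond it, however many of the \<open>s k\<close>
  earlier indices it uses up. The growth of \<open>d\<close> makes the earlier seminorms negligible.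
\<close>

locale gap_blocks =
  fixes N :: "nat set" and s d :: "nat \<Rightarrow> nat"
  assumes d_pos: "0 < d k"
    and d_half: "s k + 2 * d k \<le> s (Suc k)"
    and d_growth: "d (Suc k) = Suc k * (1 + 2 * d k)"
    and gap: "c \<in> N \<Longrightarrow> s k + c + d k \<le> s (Suc k) \<or> s (Suc k) + d k \<le> c"
    and N_pos: "0 \<notin> N"
begin

lemma s_less: "s k < s (Suc k)"
  using d_half[of k] d_pos[of k] by linarith

lemma s_mono: "j \<le> k \<Longrightarrow> s j \<le> s k"
  by (rule lift_Suc_mono_le[of s]) (simp_all add: less_imp_le s_less)

lemma d_mono: "j \<le> k \<Longrightarrow> d j \<le> d k"
  by (rule lift_Suc_mono_le[of d]) (simp_all add: d_growth)

definition I :: "nat \<Rightarrow> nat set" where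
  "I k = {s k..<s (Suc k)}"

lemma card_I_pos: "0 < card (I k)"
  using s_less[of k] by (simp add: I_def)

lemma I_nonempty [simp]: "I k \<noteq> {}"
  using s_less[of k] by (simp add: I_def)

lemma finite_I [simp]: "finite (I k)"
  by (simp add: I_def)

definition mean :: "nat \<Rightarrow> (nat \<Rightarrow> 'k) \<Rightarrow> 'k::real_normed_field" where
  "mean k x = (\<Sum>i\<in>I k. x i) / of_nat (card (I k))"

text \<open>
  The seminorm of \<open>x\<close> will be small if \<open>x\<close> is close to a multiple of the indicator of the block. The
  mean is an explicit multiple to subtract that depends linearly on \<open>x\<close>.
\<close>

definition dev :: "nat \<Rightarrow> (nat \<Rightarrow> 'k) \<Rightarrow> nat \<Rightarrow> 'k::real_normed_field" where
  "dev k x i = (if i \<in> I k then x i - mean k x else x i)"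

definition block_seminorm :: "nat \<Rightarrow> nat set \<Rightarrow> (nat \<Rightarrow> 'k::real_normed_field) \<Rightarrow> real" where
  "block_seminorm k J x = (\<Sum>j\<in>J. norm (dev k x j))"

text \<open>
  Only coordinates from the \<open>k\<close>-th block on count, so that the indicator of a block is invisible to
  all later seminorms.
\<close>

definition admissible :: "nat \<Rightarrow> nat set \<Rightarrow> bool" where
  "admissible k J \<longleftrightarrow> finite J \<and> J \<subseteq> {s k..} \<and> card J \<le> d k"

definition Phi :: "((nat \<Rightarrow> 'k::real_normed_field) \<Rightarrow> real) set" where
  "Phi = range (\<lambda>i x. norm (x i)) \<union> {block_seminorm k J | k J. admissible k J}"

lemma mean_add: "mean k (x + y) = mean k x + mean k y"
  by (simp add: mean_def sum.distrib add_divide_distrib)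

lemma mean_scale: "mean k (scale_seq a x) = a * mean k x"
  by (simp add: mean_def sum_distrib_left)

lemma dev_add: "dev k (x + y) i = dev k x i + dev k y i"
  by (simp add: dev_def mean_add)

lemma dev_scale: "dev k (scale_seq a x) i = a * dev k x i"
  by (simp add: dev_def mean_scale algebra_simps)

lemma norm_mean_le: "norm (mean k x) \<le> (\<Sum>i\<in>I k. norm (x i)) / card (I k)"
  unfolding mean_def norm_divide norm_of_nat by (intro divide_right_mono norm_sum) simp

lemma norm_dev_le:
  assumes "\<And>i. norm (x i) \<le> M"
  shows "norm (dev k x j) \<le> 2 * M"
proof -
  have "M \<ge> 0"
    using assms[of 0] norm_ge_zero[of "x 0"] by linarith
  have "(\<Sum>i\<in>I k. norm (x i)) \<le> (\<Sum>i\<in>I k. M)"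
    by (intro sum_mono assms)
  then have "(\<Sum>i\<in>I k. norm (x i)) / card (I k) \<le> M"
    using card_I_pos[of k] by (simp add: field_simps)
  then have "norm (mean k x) \<le> M"
    using norm_mean_le[of k x] by linarith
  then show ?thesis
    using assms[of j] norm_triangle_ineq4[of "x j" "mean k x"] \<open>M \<ge> 0\<close> by (simp add: dev_def)
qed

text \<open>
  This complements the pointwise bound by twice the largest entry: it is the one that is good
  for vectors with few nonzero entries.
\<close>

lemma block_seminorm_le:
  assumes J: "finite J"
  shows "block_seminorm k J x \<le> (\<Sum>j\<in>J. norm (x j)) + (\<Sum>i\<in>I k. norm (x i))"
proof -
  have "block_seminorm k J x \<le> (\<Sum>j\<in>J. norm (x j) + (if j \<in> I k then norm (mean k x) else 0))"
    unfolding block_seminorm_def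
    by (rule sum_mono) (auto simp: dev_def norm_triangle_ineq4)
  also have "\<dots> = (\<Sum>j\<in>J. norm (x j)) + card (J \<inter> I k) * norm (mean k x)"
    using J by (simp add: sum.distrib sum.If_cases)
  also have "card (J \<inter> I k) * norm (mean k x) \<le> card (I k) * ((\<Sum>i\<in>I k. norm (x i)) / card (I k))"
    by (intro mult_mono norm_mean_le) (auto intro: card_mono)
  also have "\<dots> = (\<Sum>i\<in>I k. norm (x i))"
    using card_I_pos[of k] by simp
  finally show ?thesis
    by simp
qed

lemma seminorm_family_Phi:
  "seminorm_family (Phi :: ((nat \<Rightarrow> 'k::{real_normed_field,euclidean_space}) \<Rightarrow> real) set) 2"
proof
  fix p :: "(nat \<Rightarrow> 'k) \<Rightarrow> real" and x y :: "nat \<Rightarrow> 'k" and a :: 'k and i :: nat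
  assume "p \<in> Phi"
  then consider (coord) j where "p = (\<lambda>x. norm (x j))"
    | (block) k J where "p = block_seminorm k J" "admissible k J"
    unfolding Phi_def by blast
  note cases = this
  show "p (x + y) \<le> p x + p y"
  proof (cases rule: cases)
    case coord
    then show ?thesis
      by (simp add: norm_triangle_ineq)
  next
    case block
    have "block_seminorm k J (x + y) \<le> (\<Sum>j\<in>J. norm (dev k x j) + norm (dev k y j))"
      unfolding block_seminorm_def dev_add by (intro sum_mono norm_triangle_ineq)
    then show ?thesis
      by (simp add: block sum.distrib block_seminorm_def)
  qed
  show "p (scale_seq a x) = norm a * p x"
    by (cases rule: cases)
      (simp_all add: norm_mult block_seminorm_def dev_scale sum_distrib_left)
  show "p (unit_seq i) \<le> 2"
  proof (cases rule: cases)
    case coord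
    then show ?thesis
      by simp
  next
    case block
    have unit: "(\<Sum>j\<in>S. norm (unit_seq i j :: 'k)) \<le> 1" if "finite S" for S
      using that by (simp add: if_distrib[of norm] cong: if_cong)
    have "finite J"
      using block by (simp add: admissible_def)
    then show ?thesis
      using block_seminorm_le[of J k "unit_seq i :: nat \<Rightarrow> 'k"] unit[of J] unit[of "I k"]
      unfolding block by simp
  qed
  fix Z :: "nat \<Rightarrow> nat \<Rightarrow> 'k"
  assume Z: "\<And>i. (\<lambda>m. Z m i) \<longlonglongrightarrow> x i"
  show "(\<lambda>m. p (Z m)) \<longlonglongrightarrow> p x"
  proof (cases rule: cases)
    case coord
    then show ?thesis
      by (simp add: Z tendsto_norm)
  next
    case block
    have "(\<lambda>m. mean k (Z m)) \<longlonglongrightarrow> mean k x"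
      unfolding mean_def using card_I_pos[of k] by (intro tendsto_intros Z) auto
    then have "(\<lambda>m. dev k (Z m) j) \<longlonglongrightarrow> dev k x j" for j
      unfolding dev_def by (cases "j \<in> I k") (auto intro!: tendsto_intros Z)
    then show ?thesis
      unfolding block block_seminorm_def by (intro tendsto_intros)
  qed
qed (auto simp: Phi_def)

end

locale block_space = gap_blocks +
  fixes h :: "(nat \<Rightarrow> 'k::{real_normed_field,euclidean_space}) \<Rightarrow> 'u"
  assumes inj: "inj h"
begin

sublocale realized_seminorm_family Phi 2 h
  by (intro realized_seminorm_family.intro realized_seminorm_family_axioms.intro
      seminorm_family_Phi inj)

definition vec :: "(nat \<Rightarrow> 'k) \<Rightarrow> nat set \<Rightarrow> nat \<Rightarrow> 'k" where
  "vec a A = (\<lambda>i. if i \<in> A then a i else 0)"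

lemma vec_in_seqs: "finite A \<Longrightarrow> vec a A \<in> seqs"
  by (rule seqs_finite_support) (auto simp: vec_def elim: finite_subset[rotated])

lemma nrm_lin_comb: "finite A \<Longrightarrow> nrm V (lin_comb V e a A) = gauge (vec a A)"
  by (simp only: lin_comb_h V_simps vec_def)

lemma block_seminorm_le_gauge: "x \<in> seqs \<Longrightarrow> admissible k J \<Longrightarrow> block_seminorm k J x \<le> gauge x"
  by (rule phi_le_gauge) (auto simp: Phi_def)

lemma block_upper:
  assumes A: "finite A" and a: "\<And>i. i \<in> A \<Longrightarrow> norm (a i) \<le> c" "0 \<le> c" and J: "admissible k J"
  shows "block_seminorm k J (vec a A) \<le> 2 * c * min (card (A \<inter> {s k..})) (d k)"
proof -
  have norm_vec: "norm (vec a A i) \<le> (if i \<in> A then c else 0)" for i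
    using a by (simp add: vec_def)
  then have le_c: "norm (vec a A i) \<le> c" for i
    by (rule order_trans) (simp add: a)
  have sum_le: "(\<Sum>i\<in>S. norm (vec a A i)) \<le> c * card (A \<inter> {s k..})" if S: "finite S" "S \<subseteq> {s k..}" for S
  proof -
    have "(\<Sum>i\<in>S. norm (vec a A i)) \<le> (\<Sum>i\<in>S. if i \<in> A then c else 0)"
      by (intro sum_mono norm_vec)
    also have "\<dots> = c * card (S \<inter> A)"
      using S by (simp add: sum.If_cases)
    also have "\<dots> \<le> c * card (A \<inter> {s k..})"
      using S A a by (intro mult_left_mono of_nat_mono card_mono) auto
    finally show ?thesis .
  qed
  have "block_seminorm k J (vec a A) \<le> c * card (A \<inter> {s k..}) + c * card (A \<inter> {s k..})"
    using J by (intro order_trans[OF block_seminorm_le] add_mono sum_le)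
      (auto simp: admissible_def I_def)
  moreover have "block_seminorm k J (vec a A) \<le> 2 * c * d k"
  proof -
    have "block_seminorm k J (vec a A) \<le> (\<Sum>j\<in>J. 2 * c)"
      unfolding block_seminorm_def by (intro sum_mono norm_dev_le le_c)
    also have "\<dots> = 2 * c * card J"
      by simp
    also have "\<dots> \<le> 2 * c * d k"
      using J a by (intro mult_left_mono) (auto simp: admissible_def)
    finally show ?thesis .
  qed
  ultimately show ?thesis
    by (simp add: min_def)
qed

text \<open>
  Together with the preceding upper bound this determines the \<open>k\<close>-th seminorm up to constants, for
  sets of a size in \<open>N\<close>, by the size of the coefficients and the number \<open>min (card (A \<inter> {s k..})) (d k)\<close>,
  independently of signs. If \<open>A\<close> has many elements beyond the block, these already suffice. Otherwise
  \<open>A\<close> misses \<open>d k\<close> elements of the block. A large mean is then visible at the missed elements, and a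
  small mean cannot cancel the entries at the elements of \<open>A\<close>.
\<close>

lemma block_lower:
  assumes A: "finite A" "card A \<in> N" and b: "\<And>i. i \<in> A \<Longrightarrow> c \<le> norm (b i)" "0 \<le> c"
  shows "c / 2 * min (card (A \<inter> {s k..})) (d k) \<le> gauge (vec b A)"
proof -
  let ?x = "vec b A"
  have bound: "c / 2 * min (card (A \<inter> {s k..})) (d k) \<le> gauge ?x"
    if J: "admissible k J" "min (card (A \<inter> {s k..})) (d k) \<le> card J"
      and dev: "\<And>j. j \<in> J \<Longrightarrow> c / 2 \<le> norm (dev k ?x j)" for J
  proof -
    have "c / 2 * min (card (A \<inter> {s k..})) (d k) \<le> c / 2 * card J"
      using J b by (intro mult_left_mono of_nat_mono) auto
    also have "\<dots> = (\<Sum>j\<in>J. c / 2)"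
      by simp
    also have "\<dots> \<le> block_seminorm k J ?x"
      unfolding block_seminorm_def by (intro sum_mono dev)
    also have "\<dots> \<le> gauge ?x"
      by (intro block_seminorm_le_gauge vec_in_seqs A J)
    finally show ?thesis .
  qed
  show ?thesis
  proof (cases "s (Suc k) + d k \<le> card A")
    case True
    have "card A \<le> card (A \<inter> {s (Suc k)..}) + card {..<s (Suc k)}"
    proof -
      have "A \<subseteq> (A \<inter> {s (Suc k)..}) \<union> {..<s (Suc k)}"
        by auto
      then have "card A \<le> card ((A \<inter> {s (Suc k)..}) \<union> {..<s (Suc k)})"
        using A by (intro card_mono) auto
      also have "\<dots> \<le> card (A \<inter> {s (Suc k)..}) + card {..<s (Suc k)}"
        by (rule card_Un_le)
      finally show ?thesis .
    qed
    then have "d k \<le> card (A \<inter> {s (Suc k)..})"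
      using True by simp
    then obtain J where J: "J \<subseteq> A \<inter> {s (Suc k)..}" "card J = d k" "finite J"
      by (rule obtain_subset_with_card_n)
    show ?thesis
    proof (rule bound)
      show "admissible k J"
        using J s_less[of k] by (auto simp: admissible_def)
      show "c / 2 \<le> norm (dev k ?x j)" if "j \<in> J" for j
        using that J b(1)[of j] b(2) by (auto simp: dev_def vec_def I_def)
    qed (use J in auto)
  next
    case False
    then have small: "s k + card A + d k \<le> s (Suc k)"
      using gap[OF A(2), of k] by auto
    show ?thesis
    proof (cases "c / 2 \<le> norm (mean k ?x)")
      case True
      have "card (I k) - card A \<le> card (I k - A)"
        by (rule diff_card_le_card_Diff[OF A(1)])
      then have "d k \<le> card (I k - A)"
        using small by (simp add: I_def)
      then obtain J where J: "J \<subseteq> I k - A" "card J = d k" "finite J"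
        by (rule obtain_subset_with_card_n)
      show ?thesis
      proof (rule bound)
        show "admissible k J"
          using J by (auto simp: admissible_def I_def)
        show "c / 2 \<le> norm (dev k ?x j)" if "j \<in> J" for j
          using that J True by (auto simp: dev_def vec_def subset_iff)
      qed (use J in auto)
    next
      case False
      obtain J where J: "J \<subseteq> A \<inter> {s k..}" "card J = min (card (A \<inter> {s k..})) (d k)" "finite J"
        using obtain_subset_with_card_n[of "min (card (A \<inter> {s k..})) (d k)" "A \<inter> {s k..}"] by auto
      show ?thesis
      proof (rule bound)
        show "admissible k J"
          using J by (auto simp: admissible_def)
        show "c / 2 \<le> norm (dev k ?x j)" if j: "j \<in> J" for j
        proof -
          have "c \<le> norm (?x j)"
            using J b(1)[of j] j by (auto simp: vec_def)
          then show ?thesis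
            using False b(2) norm_triangle_ineq2[of "?x j" "mean k ?x"] by (auto simp: dev_def)
        qed
      qed (use J in auto)
    qed
  qed
qed

text \<open>
  Both inequalities of the UL property are instances: compare the given coefficients with the constant
  maximum from above, and with the constant minimum from below.
\<close>

lemma gauge_compare:
  assumes A: "finite A" "card A \<in> N"
    and a: "\<And>i. i \<in> A \<Longrightarrow> norm (a i) \<le> c" and b: "\<And>i. i \<in> A \<Longrightarrow> c \<le> norm (b i)" and c: "0 \<le> c"
  shows "gauge (vec a A) \<le> 4 * gauge (vec b A)"
proof (rule gauge_le)
  fix p :: "(nat \<Rightarrow> 'k) \<Rightarrow> real"
  assume "p \<in> Phi"
  then consider (coord) i where "p = (\<lambda>x. norm (x i))"
    | (block) k J where "p = block_seminorm k J" "admissible k J"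
    unfolding Phi_def by blast
  then show "p (vec a A) \<le> 4 * gauge (vec b A)"
  proof cases
    case coord
    have "norm (vec a A i) \<le> norm (vec b A i)"
      using a[of i] b[of i] by (auto simp: vec_def)
    then show ?thesis
      using coordinate_le_gauge[OF vec_in_seqs[OF A(1)], of b i] gauge_nonneg[OF vec_in_seqs[OF A(1)], of b]
      by (simp add: coord)
  next
    case block
    have "block_seminorm k J (vec a A) \<le> 2 * c * min (card (A \<inter> {s k..})) (d k)"
      by (rule block_upper) (use A a c block(2) in auto)
    moreover have "c / 2 * min (card (A \<inter> {s k..})) (d k) \<le> gauge (vec b A)"
      by (rule block_lower) (use A b c in auto)
    ultimately show ?thesis
      by (simp add: block)
  qed
qed

lemma UL_property_V: "UL_property N V e"
proof -
  have "1 / 4 * (MIN i\<in>A. norm (a i)) * nrm V (lin_comb V e (\<lambda>_. 1) A) \<le> nrm V (lin_comb V e a A) \<and>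
      nrm V (lin_comb V e a A) \<le> 4 * (MAX i\<in>A. norm (a i)) * nrm V (lin_comb V e (\<lambda>_. 1) A)"
    if A: "finite A" "card A \<in> N" for A and a :: "nat \<Rightarrow> 'k"
  proof -
    define m M where "m = (MIN i\<in>A. norm (a i))" and "M = (MAX i\<in>A. norm (a i))"
    have ne: "A \<noteq> {}"
      using A N_pos by auto
    have m: "m \<le> norm (a i)" and M: "norm (a i) \<le> M" if "i \<in> A" for i
      using A that by (auto simp: m_def M_def)
    have m0: "m \<ge> 0"
      using A ne unfolding m_def by (intro Min.boundedI) auto
    have M0: "M \<ge> 0"
      using ne M order_trans[OF norm_ge_zero] by blast
    have const: "gauge (vec (\<lambda>_. of_real r) A) = r * gauge (vec (\<lambda>_. 1) A)" if "r \<ge> 0" for r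
    proof -
      have "vec (\<lambda>_. of_real r) A = scale_seq (of_real r) (vec (\<lambda>_. 1) A)"
        by (auto simp: vec_def fun_eq_iff)
      then show ?thesis
        using that by (simp add: gauge_scale vec_in_seqs A(1))
    qed
    have "gauge (vec (\<lambda>_. of_real m) A) \<le> 4 * gauge (vec a A)"
      by (rule gauge_compare[OF A, of _ m]) (use m m0 in auto)
    moreover have "gauge (vec a A) \<le> 4 * gauge (vec (\<lambda>_. of_real M) A)"
      by (rule gauge_compare[OF A, of _ M]) (use M M0 in auto)
    ultimately show ?thesis
      by (simp add: const m0 M0 nrm_lin_comb A(1) flip: m_def M_def)
  qed
  then show ?thesis
    unfolding UL_property_def
    by (intro exI[of _ 4] conjI allI impI) (auto elim: conjE)
qed

text \<open>
  The seminorm of the block itself vanishes because the indicator is constant there, the later ones do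
  not see the block, and the earlier ones add up at most \<open>d k\<close> values, each of them at most 2.
\<close>

lemma gauge_block_indicator: "gauge (vec (\<lambda>_. 1) (I (Suc k))) \<le> 1 + 2 * d k"
proof (rule gauge_le)
  let ?x = "vec (\<lambda>_. 1) (I (Suc k))"
  have x_le: "norm (?x i) \<le> 1" for i
    by (simp add: vec_def)
  fix p :: "(nat \<Rightarrow> 'k) \<Rightarrow> real"
  assume "p \<in> Phi"
  then consider (coord) i where "p = (\<lambda>x. norm (x i))"
    | (block) j J where "p = block_seminorm j J" "admissible j J"
    unfolding Phi_def by blast
  then show "p ?x \<le> 1 + 2 * d k"
  proof cases
    case coord
    then show ?thesis
      using x_le[of i] by simp
  next
    case block
    consider "j \<le> k" | "j = Suc k" | "Suc (Suc k) \<le> j"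
      by linarith
    then have "block_seminorm j J ?x \<le> 2 * d k"
    proof cases
      case 1
      have "block_seminorm j J ?x \<le> (\<Sum>i\<in>J. 2 * 1)"
        unfolding block_seminorm_def by (intro sum_mono norm_dev_le x_le)
      also have "\<dots> \<le> 2 * d k"
        using block(2) d_mono[OF 1] by (simp add: admissible_def)
      finally show ?thesis .
    next
      case 2
      have "mean j ?x = 1"
        using card_I_pos[of j] by (simp add: mean_def vec_def 2)
      then have "dev j ?x i = 0" for i
        by (simp add: dev_def vec_def 2)
      then show ?thesis
        by (simp add: block_seminorm_def)
    next
      case 3
      have zero: "?x i = 0" if "s j \<le> i" for i
        using s_mono[OF 3] that by (auto simp: vec_def I_def)
      have "?x i = 0" if "i \<in> J \<union> I j" for i
        by (rule zero) (use that block(2) in \<open>auto simp: admissible_def I_def\<close>)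
      then have vanish: "(\<Sum>i\<in>J. norm (?x i)) = 0" "(\<Sum>i\<in>I j. norm (?x i)) = 0"
        by (auto intro!: sum.neutral)
      have "block_seminorm j J ?x \<le> (\<Sum>i\<in>J. norm (?x i)) + (\<Sum>i\<in>I j. norm (?x i))"
        by (rule block_seminorm_le) (use block(2) in \<open>simp add: admissible_def\<close>)
      then show ?thesis
        unfolding vanish by simp
    qed
    then show ?thesis
      by (simp add: block)
  qed
qed

text \<open>
  Flip \<open>d k\<close> signs. As these are at most half of the block, the mean stays nonnegative, and the
  flipped entries deviate from it by at least 1.
\<close>

lemma gauge_block_signs:
  obtains \<epsilon> :: "nat \<Rightarrow> 'k" where "\<And>i. norm (\<epsilon> i) = 1" "d k \<le> gauge (vec \<epsilon> (I k))"
proof -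
  have half: "2 * d k \<le> card (I k)"
    using d_half[of k] by (simp add: I_def)
  then obtain J where J: "J \<subseteq> I k" "card J = d k" "finite J"
    using obtain_subset_with_card_n[of "d k" "I k"] by auto
  define \<epsilon> :: "nat \<Rightarrow> 'k" where "\<epsilon> = (\<lambda>i. if i \<in> J then -1 else 1)"
  define r where "r = 1 - 2 * real (d k) / card (I k)"
  have r: "r \<ge> 0"
    using half card_I_pos[of k] by (simp add: r_def field_simps flip: of_nat_mult)
  have "(\<Sum>i\<in>I k. \<epsilon> i) = (\<Sum>i\<in>I k. 1 - (if i \<in> J then 2 else 0))"
    by (intro sum.cong) (auto simp: \<epsilon>_def)
  also have "\<dots> = of_nat (card (I k)) - 2 * of_nat (d k)"
    using J by (simp add: sum_subtractf sum.If_cases Int_absorb1)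
  finally have "mean k (vec \<epsilon> (I k)) = (of_nat (card (I k)) - 2 * of_nat (d k)) / of_nat (card (I k))"
    by (simp add: mean_def vec_def)
  also have "\<dots> = of_real r"
    using card_I_pos[of k] by (simp add: r_def diff_divide_distrib)
  finally have mean: "mean k (vec \<epsilon> (I k)) = of_real r" .
  have "1 \<le> norm (dev k (vec \<epsilon> (I k)) j)" if "j \<in> J" for j
  proof -
    have "dev k (vec \<epsilon> (I k)) j = of_real (-1 - r)"
    proof -
      have "vec \<epsilon> (I k) j = -1" "j \<in> I k"
        using that J by (auto simp: vec_def \<epsilon>_def)
      then show ?thesis
        by (simp add: dev_def mean)
    qed
    then show ?thesis
      using r by (simp only: norm_of_real)
  qed
  then have "(\<Sum>j\<in>J. 1) \<le> block_seminorm k J (vec \<epsilon> (I k))"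
    unfolding block_seminorm_def by (rule sum_mono)
  also have "\<dots> \<le> gauge (vec \<epsilon> (I k))"
    by (intro block_seminorm_le_gauge vec_in_seqs) (use J in \<open>auto simp: admissible_def I_def\<close>)
  finally have "d k \<le> gauge (vec \<epsilon> (I k))"
    using J by simp
  moreover have "norm (\<epsilon> i) = 1" for i
    by (simp add: \<epsilon>_def)
  ultimately show ?thesis
    using that by blast
qed

lemma not_uncond_const_coeff: "\<not> uncond_const_coeff {1..} V e"
proof
  assume "uncond_const_coeff {1..} V e"
  then obtain C where C: "\<And>A \<epsilon> \<epsilon>'. finite A \<and> card A \<in> {1..} \<and>
        (\<forall>i\<in>A. norm (\<epsilon> i) = 1) \<and> (\<forall>i\<in>A. norm (\<epsilon>' i) = 1) \<Longrightarrow>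
        nrm V (lin_comb V e \<epsilon> A) \<le> C * nrm V (lin_comb V e \<epsilon>' A)" and "C > 0"
    unfolding uncond_const_coeff_def by metis
  obtain k :: nat where k: "C < k"
    using reals_Archimedean2 by blast
  obtain \<epsilon> :: "nat \<Rightarrow> 'k" where \<epsilon>: "\<And>i. norm (\<epsilon> i) = 1" "d (Suc k) \<le> gauge (vec \<epsilon> (I (Suc k)))"
    using gauge_block_signs by blast
  have "real (d (Suc k)) \<le> C * gauge (vec (\<lambda>_. 1) (I (Suc k)))"
    using C[of "I (Suc k)" \<epsilon> "\<lambda>_. 1"] \<epsilon> card_I_pos[of "Suc k"] by (simp add: nrm_lin_comb)
  also have "\<dots> \<le> C * (1 + 2 * d k)"
    using \<open>C > 0\<close> gauge_block_indicator by (intro mult_left_mono) auto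
  also have "\<dots> < Suc k * real (1 + 2 * d k)"
    using k by (intro mult_strict_right_mono) auto
  also have "\<dots> = real (d (Suc k))"
    by (simp only: d_growth of_nat_mult)
  finally show False
    by simp
qed

end

section \<open>Unbounded gaps leave room for the blocks\<close>

text \<open>
  Only finitely many gaps come before any given term, so unbounded gaps provide, for every \<open>L\<close>, one of
  length at least \<open>L\<close> after at least \<open>L\<close> terms. With \<open>L = 2 * d k + s k\<close> the block length is placed \<open>d k\<close> after the
  beginning of the gap; what remains up to its end is \<open>d k\<close>, plus \<open>s k\<close> for the earlier blocks.
\<close>

lemma gap_blocks_exist:
  assumes n: "gap_sequence n" and unb: "\<not> bounded_additive_gaps n"
  obtains s d where "gap_blocks (range n) s d"
proof -
  have mono: "strict_mono n" and pos: "\<And>k. 0 < n k"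
    using n by (auto simp: gap_sequence_def)
  have "\<exists>p\<ge>L. n p + L \<le> n (Suc p)" for L
  proof -
    \<comment> \<open>A gap longer than \<open>n L\<close> cannot end at or before the term \<open>n L\<close>.\<close>
    obtain p where p: "n (Suc p) - n p > L + n L + 2"
      using unb unfolding bounded_additive_gaps_def by (metis le_add2 not_le)
    have "p \<ge> L"
    proof (rule ccontr)
      assume "\<not> p \<ge> L"
      then have "n (Suc p) \<le> n L"
        using mono by (simp add: strict_mono_less_eq)
      then show False
        using p by linarith
    qed
    then show ?thesis
      using p by (intro exI[of _ p]) auto
  qed
  then obtain P where P: "\<And>L. P L \<ge> L" "\<And>L. n (P L) + L \<le> n (Suc (P L))"
    by metis
  define d :: "nat \<Rightarrow> nat" where "d = rec_nat 1 (\<lambda>k x. Suc k * (1 + 2 * x))"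
  define s :: "nat \<Rightarrow> nat" where
    "s = rec_nat 0 (\<lambda>k x. x + n (P (2 * d k + x)) + d k)"
  have d: "d 0 = 1" "\<And>k. d (Suc k) = Suc k * (1 + 2 * d k)"
    by (simp_all add: d_def)
  have s: "\<And>k. s (Suc k) = s k + n (P (2 * d k + s k)) + d k"
    by (simp add: s_def)
  have "gap_blocks (range n) s d"
  proof
    show "0 < d k" for k
      by (cases k) (simp_all add: d)
    show "d (Suc k) = Suc k * (1 + 2 * d k)" for k
      by (rule d)
    show "s k + 2 * d k \<le> s (Suc k)" for k
      using strict_mono_imp_increasing[OF mono, of "P (2 * d k + s k)"] P(1)[of "2 * d k + s k"]
      by (simp add: s)
    show "0 \<notin> range n"
      using pos by (metis imageE less_irrefl)
    fix c k
    assume "c \<in> range n"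
    then obtain j where j: "c = n j"
      by blast
    let ?p = "P (2 * d k + s k)"
    show "s k + c + d k \<le> s (Suc k) \<or> s (Suc k) + d k \<le> c"
    proof (cases "j \<le> ?p")
      case True
      then have "n j \<le> n ?p"
        using mono by (simp add: strict_mono_less_eq)
      then show ?thesis
        by (simp add: s j)
    next
      case False
      then have "n (Suc ?p) \<le> n j"
        using mono by (simp add: strict_mono_less_eq)
      then show ?thesis
        using P(2)[of "2 * d k + s k"] by (simp add: s j)
    qed
  qed
  then show ?thesis
    by (rule that)
qed

lemma counterexample:
  fixes n :: "nat \<Rightarrow> nat"
  assumes "gap_sequence n" "\<not> bounded_additive_gaps n"
    and "(UNIV :: real set) \<lesssim> (UNIV :: 'u set)"
  obtains V :: "('k::{real_normed_field,euclidean_space}, 'u) nspace" and e where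
    "banach_space V" "markushevich_basis V e" "UL_property (range n) V e"
    "\<not> uncond_const_coeff {1..} V e"
proof -
  obtain h :: "(nat \<Rightarrow> 'k) \<Rightarrow> 'u" where h: "inj h"
    using sequences_inject[OF assms(3)] by blast
  obtain s d where "gap_blocks (range n) s d"
    using gap_blocks_exist[OF assms(1,2)] by blast
  then interpret block_space "range n" s d h
    by (intro block_space.intro block_space_axioms.intro h)
  show ?thesis
    by (rule that[OF banach markushevich UL_property_V not_uncond_const_coeff])
qed

theorem corollary2p7:
  fixes n :: "nat \<Rightarrow> nat"
  assumes "gap_sequence n"
    and "(UNIV :: real set) \<lesssim> (UNIV :: 'u set)"
  shows
    "(bounded_additive_gaps n \<longleftrightarrow>
       (\<forall>(V :: ('k::{real_normed_field,euclidean_space}, 'u) nspace) e.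
          banach_space V \<and> is_basis V e \<and> uncond_const_coeff (range n) V e
          \<longrightarrow> uncond_const_coeff {1..} V e)) \<and>
     (bounded_additive_gaps n \<longleftrightarrow>
       (\<forall>(V :: ('k, 'u) nspace) e.
          banach_space V \<and> markushevich_basis V e \<and> uncond_const_coeff (range n) V e
          \<longrightarrow> uncond_const_coeff {1..} V e)) \<and>
     (bounded_additive_gaps n \<longleftrightarrow>
       (\<forall>(V :: ('k, 'u) nspace) e.
          banach_space V \<and> is_basis V e \<and> UL_property (range n) V e
          \<longrightarrow> UL_property {1..} V e)) \<and>
     (bounded_additive_gaps n \<longleftrightarrow>
       (\<forall>(V :: ('k, 'u) nspace) e.
          banach_space V \<and> markushevich_basis V e \<and> UL_property (range n) V e
          \<longrightarrow> UL_property {1..} V e))"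
proof -
  have markushevich_imp_basis: "is_basis V e" if "markushevich_basis V e"
    for V :: "('k, 'u) nspace" and e
    using that unfolding markushevich_basis_def is_basis_def by blast
  show ?thesis
  proof (cases "bounded_additive_gaps n")
    case True
    show ?thesis
      using True markushevich_imp_basis uncond_const_coeff_bounded_gaps[OF assms(1) True]
        UL_property_bounded_gaps[OF assms(1) True]
      by (intro conjI) blast+
  next
    case False
    obtain V :: "('k, 'u) nspace" and e where V: "banach_space V" "markushevich_basis V e"
      "UL_property (range n) V e" "\<not> uncond_const_coeff {1..} V e"
      using counterexample[OF assms(1) False assms(2)] by blast
    have "0 \<notin> range n"
      using assms(1) unfolding gap_sequence_def by (metis imageE less_irrefl)
    then have "uncond_const_coeff (range n) V e"
      by (rule UL_property_imp_uncond_const_coeff[OF V(3)])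
    moreover have "\<not> UL_property {1..} V e"
      using V(4) UL_property_imp_uncond_const_coeff[of "{1..}" V e] by auto
    ultimately show ?thesis
      using False V markushevich_imp_basis[OF V(2)] by (intro conjI) blast+
  qed
qed

end
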